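(* For the analytic continuation of $\hat{N}_{W}(a,x)=W(a,x)\int_{x}^{\infty} W(a,-t)dt-W(a,-x) \int_{x}^{\infty} W(a,t)dt$ to complex argument $z$ (via the extension of $W(a,z)$ below) we have \[ \hat{N}_{W}(a,z)=W_{0}^{(0,3)}(a,z) =ie^{\pi a/2}\left[W_{3}(a,z) \int_{e^{\pi i/4}\infty}^z W_{0}(a,t)dt -W_{0}(a,z) \int_{e^{-\pi i/4}\infty}^z W_{3}(a,t)dt \right]. \]
   Context: Throughout, $a$ is real. $W(a,\pm x)$ are the Weber parabolic cylinder functions (DLMF Sect. 12.14), numerically satisfactory solutions for real $a,x$ of $y''+(\tfrac14 x^2-a)y=0$. $U(a,z)$ is the standard parabolic cylinder function, the solution of $y''-(\tfrac14 z^2+a)y=0$ with $U(a,z)\sim z^{-a-1/2}e^{-z^2/4}$ as $z\to\infty$, $|\arg z|\le \tfrac34\pi-\delta$. For $j=0,1,2,3$, $W_{j}(a,z)=U\left((-1)^{j}ia,(-i)^{j}ze^{-\pi i/4}\right)$; these solve $y''+(\tfrac14 z^2-a)y=0$. $W(a,z)$ is extended to complex $z$ by $W(a,z)=\sqrt{\tfrac{1}{2}k}\, e^{\pi a/4}\{ e^{i\rho}W_{0}(a,z)+e^{-i\rho }W_{3}(a,z)\}$, where $k=\sqrt{1+e^{2\pi a}}-e^{\pi a}$, $\rho=\tfrac12\phi_2+\tfrac18\pi$, $\phi_2=\arg\Gamma(\tfrac12+ia)$ (branch zero at $a=0$, continuous). The complementary Nield-Kuznetsov function is $\hat{N}_{W}(a,x)=W(a,x)\int_{x}^{\infty}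 W(a,-t)dt-W(a,-x) \int_{x}^{\infty} W(a,t)dt$ for real $x$; $-\hat N_W$ solves $y''+(\tfrac14 x^2-a)y=-1$. For nonnegative integers $R$, $W_{R}^{(0,3)}(a,z)=ie^{\pi a/2}[W_{3}(a,z)\int_{e^{\pi i/4}\infty}^z t^{R}W_{0}(a,t)dt-W_{0}(a,z)\int_{e^{-\pi i/4}\infty}^z t^{R}W_{3}(a,t)dt]$, a solution of $y''+(\tfrac14 z^2-a)y=z^R$. *)

theory Defs
  imports "HOL-Complex_Analysis.Complex_Analysis"
begin

definition PCF_U :: "complex \<Rightarrow> complex \<Rightarrow> complex" where
  "PCF_U a = (THE f. f holomorphic_on UNIV \<and>
      (\<forall>z. deriv (deriv f) z = (z\<^sup>2 / 4 + a) * f z) \<and>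
      (\<forall>\<delta>>0. ((\<lambda>z. f z / (z powr (- a - 1/2) * exp (- z\<^sup>2 / 4))) \<longlongrightarrow> 1)
              (inf at_infinity (principal {z. \<bar>Arg z\<bar> \<le> 3 * pi / 4 - \<delta>}))))"

definition Wj :: "nat \<Rightarrow> real \<Rightarrow> complex \<Rightarrow> complex" where
  "Wj j a z = PCF_U ((-1) ^ j * \<i> * complex_of_real a)
                    ((- \<i>) ^ j * z * exp (- pi * \<i> / 4))"

definition phi2 :: "real \<Rightarrow> real" where
  "phi2 = (THE \<phi>. continuous_on UNIV \<phi> \<and> \<phi> 0 = 0 \<and>
      (\<forall>a. Gamma (1/2 + \<i> * complex_of_real a) =
            complex_of_real (cmod (Gamma (1/2 + \<i> * complex_of_real a)))
              * exp (\<i> * complex_of_real (\<phi> a))))"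

definition kW :: "real \<Rightarrow> real" where
  "kW a = sqrt (1 + exp (2 * pi * a)) - exp (pi * a)"

definition rhoW :: "real \<Rightarrow> real" where
  "rhoW a = phi2 a / 2 + pi / 8"

text \<open>Weber function W(a,z) for complex z (agrees with the real W(a,x) for real x).\<close>
definition Wc :: "real \<Rightarrow> complex \<Rightarrow> complex" where
  "Wc a z = complex_of_real (sqrt (kW a / 2) * exp (pi * a / 4)) *
     (exp (\<i> * complex_of_real (rhoW a)) * Wj 0 a z
      + exp (- \<i> * complex_of_real (rhoW a)) * Wj 3 a z)"

definition improper_int :: "(real \<Rightarrow> complex) \<Rightarrow> real \<Rightarrow> complex" where
  "improper_int f x = Lim at_top (\<lambda>T. integral {x..T} f)"

definition NW_hat :: "real \<Rightarrow> real \<Rightarrow> complex" where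
  "NW_hat a x = Wc a (complex_of_real x) * improper_int (\<lambda>t. Wc a (complex_of_real (- t))) x
              - Wc a (complex_of_real (- x)) * improper_int (\<lambda>t. Wc a (complex_of_real t)) x"

text \<open>Contour integral from omega*infinity to z, taken along the ray
  {z + s*omega : s >= 0}:  int_{omega infinity}^z f = - lim_{T->oo} int_[z, z+T omega] f.\<close>
definition int_from_inf :: "complex \<Rightarrow> (complex \<Rightarrow> complex) \<Rightarrow> complex \<Rightarrow> complex" where
  "int_from_inf \<omega> f z =
     - Lim at_top (\<lambda>T::real. contour_integral (linepath z (z + complex_of_real T * \<omega>)) f)"

definition W03 :: "nat \<Rightarrow> real \<Rightarrow> complex \<Rightarrow> complex" where
  "W03 R a z = \<i> * complex_of_real (exp (pi * a / 2)) *
     (Wj 3 a z * int_from_inf (exp (pi * \<i> / 4)) (\<lambda>t. t ^ R * Wj 0 a t) z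
      - Wj 0 a z * int_from_inf (exp (- pi * \<i> / 4)) (\<lambda>t. t ^ R * Wj 3 a t) z)"

end

theory Submission
  imports Defs
begin

text \<open>For \<open>Re b > 0\<close>, \<open>b = a + 1/2\<close>, the function
  \<open>U(a,z) = exp (- z\<^sup>2/4) / Gamma b * \<integral> s powr (b - 1) * exp (- s\<^sup>2/2 - z s) ds\<close> over \<open>s > 0\<close> is entire;
  turning the ray of integration by an angle less than \<open>\<pi>/4\<close> leaves it unchanged and gives the
  asymptotics for \<open>|arg z| < 3\<pi>/4\<close>. Being recessive on the positive axis, it is the unique solution
  described by \<open>PCF_U\<close>. Comparing values at \<open>0\<close> yields the connection formula between \<open>U(a,\<plusminus>z)\<close>
  and \<open>U(-a,\<i>z)\<close>, hence \<open>W(a,-z)\<close> is a multiple of \<open>exp (\<i>\<rho>) W\<^sub>0 - exp (- \<i>\<rho>) W\<^sub>3\<close>. In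
  \<open>W(a,x) \<integral> W(a,-t) dt - W(a,-x) \<integral> W(a,t) dt\<close> only the mixed products of \<open>W\<^sub>0\<close> and \<open>W\<^sub>3\<close> survive, and
  the real integrals of \<open>W\<^sub>0\<close> and \<open>W\<^sub>3\<close> may be moved to the rays of angle \<open>\<plusminus>\<pi>/4\<close>, where the
  integrands decay like a Gaussian.\<close>

section \<open>Laplace and Gauss integrals of complex powers\<close>

text \<open>The parameters occurring in \<open>Wj\<close> are \<open>\<i> * a\<close> and
  \<open>- \<i> * a\<close>, of real part 0. They lie in the half-plane where the integral
  converges, and in the strip where U(a,.) and U(-a,.) both have such an integral, which is why a
  representation restricted to that half-plane suffices. The obstacle is the real axis: there the
  argument of U lies on a ray of angle \<pi>/4 or -\<pi>/4, where exp(-z^2/4) has modulus 1. W_0 and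
  W_3 decay only like x^(-1/2) and their integrals over a half-line converge only conditionally.
  Hence \<open>improper_int\<close> and \<open>int_from_inf\<close> are treated through entire
  primitives of W_0 and W_3: an integral becomes a difference of values of the primitive once the
  primitive is known to have a limit, and rotating the path means that this limit is the same along
  the real axis and along the ray of rapid decay. Since \<open>THE\<close> and \<open>Lim\<close>
  carry no information without existence, U, \<open>phi2\<close> and every limit need an existence
  proof before a value can be read off.\<close>

abbreviation Mpos :: "real measure" where
  "Mpos \<equiv> lebesgue_on {0<..}"

text \<open>The Gamma integral and the change of variables are facts about absolute integrability on
  a set, dominated convergence is used for Bochner integrals. This is the bridge;
  \<open>has_bochner_integral\<close> keeps integrability and value together.\<close>

lemma has_bochner_integral_Mpos_iff:
  fixes f :: "real \<Rightarrow> complex"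
  shows "has_bochner_integral Mpos f I \<longleftrightarrow>
    f absolutely_integrable_on {0<..} \<and> integral {0<..} f = I"
proof -
  have "integrable Mpos f \<longleftrightarrow> f absolutely_integrable_on {0<..}"
    by (simp add: integrable_restrict_space set_integrable_def)
  moreover have "integral\<^sup>L Mpos f = integral {0<..} f" if "integrable Mpos f"
    using that by (simp add: lebesgue_integral_eq_integral)
  ultimately show ?thesis
    by (auto simp: has_bochner_integral_iff)
qed

lemma borel_measurable_Mpos_continuous:
  fixes f :: "real \<Rightarrow> 'b :: euclidean_space"
  assumes "continuous_on {0<..} f"
  shows "f \<in> borel_measurable Mpos"
  using assms by (intro continuous_imp_measurable_on_sets_lebesgue) auto

lemma has_bochner_integral_Mpos_substitution:
  fixes f :: "real \<Rightarrow> complex" and g h :: "real \<Rightarrow> real"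
  assumes "has_bochner_integral Mpos f I"
    and "\<And>x. x > 0 \<Longrightarrow> (g has_real_derivative h x) (at x)"
    and "\<And>x. x > 0 \<Longrightarrow> h x > 0"
    and "inj_on g {0<..}" and "g ` {0<..} = {0<..}"
  shows "has_bochner_integral Mpos (\<lambda>x. of_real (h x) * f (g x)) I"
proof -
  have "(\<lambda>x. \<bar>h x\<bar> *\<^sub>R f (g x)) absolutely_integrable_on {0<..} \<and>
        integral {0<..} (\<lambda>x. \<bar>h x\<bar> *\<^sub>R f (g x)) = I"
    using assms has_absolute_integral_change_of_variables_real[of "{0<..}" g h f I]
    by (auto simp: has_bochner_integral_Mpos_iff intro: has_field_derivative_at_within)
  then have "has_bochner_integral Mpos (\<lambda>x. \<bar>h x\<bar> *\<^sub>R f (g x)) I"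
    by (simp add: has_bochner_integral_Mpos_iff)
  then show ?thesis
    by (rule has_bochner_integral_cong[THEN iffD1, rotated -1])
      (use assms(3) in \<open>simp_all add: scaleR_conv_of_real abs_of_pos\<close>)
qed

text \<open>All partial sums of the exponential series are dominated by
  \<open>exp (r * \<bar>s\<bar>) * norm (g s)\<close>, so dominated convergence applies. It serves
  both a weight with exponential decay and one with Gaussian decay.\<close>

lemma integral_exp_mult_sums:
  fixes g :: "real \<Rightarrow> complex" and M :: "real measure"
  assumes [measurable]: "g \<in> borel_measurable M" "(\<lambda>s. s) \<in> borel_measurable M"
    and int: "integrable M (\<lambda>s. exp (r * \<bar>s\<bar>) * norm (g s))" and r: "norm z \<le> r"
  shows "integrable M (\<lambda>s. exp (z * of_real s) * g s)"
    and "(\<lambda>n. z ^ n / fact n * (\<integral>s. of_real s ^ n * g s \<partial>M)) sums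
           (\<integral>s. exp (z * of_real s) * g s \<partial>M)"
proof -
  let ?t = "\<lambda>n s. z ^ n / fact n * (of_real s ^ n * g s)"
  have r0: "r \<ge> 0" using r norm_ge_zero order_trans by blast
  have sr: "(\<lambda>n. (r * \<bar>s\<bar>) ^ n / fact n) sums exp (r * \<bar>s\<bar>)" for s
    using exp_converges[of "r * \<bar>s\<bar>"] by (simp add: divide_inverse mult.commute)
  have t_le: "norm (?t n s) \<le> (r * \<bar>s\<bar>) ^ n / fact n * norm (g s)" for n s
  proof -
    have "norm (?t n s) = (norm z * \<bar>s\<bar>) ^ n / fact n * norm (g s)"
      by (simp add: norm_mult norm_divide norm_power power_mult_distrib)
    also have "\<dots> \<le> (r * \<bar>s\<bar>) ^ n / fact n * norm (g s)"
      by (intro mult_right_mono divide_right_mono power_mono) (use r in auto)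
    finally show ?thesis .
  qed
  have sum_le: "(\<Sum>i<n. norm (?t i s)) \<le> exp (r * \<bar>s\<bar>) * norm (g s)" for n s
  proof -
    have "(\<Sum>i<n. norm (?t i s)) \<le> (\<Sum>i<n. (r * \<bar>s\<bar>) ^ i / fact i * norm (g s))"
      by (intro sum_mono t_le)
    also have "\<dots> = (\<Sum>i<n. (r * \<bar>s\<bar>) ^ i / fact i) * norm (g s)"
      by (simp add: sum_distrib_right)
    also have "\<dots> \<le> exp (r * \<bar>s\<bar>) * norm (g s)"
      using sr[of s] r0 by (intro mult_right_mono)
        (auto simp: sums_iff intro!: order_trans[OF sum_le_suminf[of _ "{..<n}"]])
    finally show ?thesis .
  qed
  have int_t: "integrable M (?t n)" for n
  proof (rule Bochner_Integration.integrable_bound[OF int])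
    show "AE s in M. norm (?t n s) \<le> norm (exp (r * \<bar>s\<bar>) * norm (g s))"
    proof (intro AE_I2)
      fix s
      have "norm (?t n s) \<le> (\<Sum>i<Suc n. norm (?t i s))"
        by (simp add: sum_nonneg)
      also note sum_le
      finally show "norm (?t n s) \<le> norm (exp (r * \<bar>s\<bar>) * norm (g s))" by simp
    qed
  qed measurable
  have pointwise: "(\<lambda>n. ?t n s) sums (exp (z * of_real s) * g s)" for s
    using sums_mult2[OF exp_converges[of "z * of_real s"], of "g s"]
    by (simp add: scaleR_conv_of_real field_simps power_mult_distrib)
  have meas: "(\<lambda>s. exp (z * of_real s) * g s) \<in> borel_measurable M"
    by measurable
  have lim: "AE s in M. (\<lambda>n. \<Sum>i<n. ?t i s) \<longlonglongrightarrow> exp (z * of_real s) * g s"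
    using pointwise by (simp add: sums_def)
  have bound: "AE s in M. norm (\<Sum>i<n. ?t i s) \<le> exp (r * \<bar>s\<bar>) * norm (g s)" for n
    by (intro AE_I2 order_trans[OF norm_sum] sum_le)
  show "integrable M (\<lambda>s. exp (z * of_real s) * g s)"
    by (rule integrable_dominated_convergence[OF meas _ int lim bound]) measurable
  have "(\<lambda>n. \<integral>s. (\<Sum>i<n. ?t i s) \<partial>M) \<longlonglongrightarrow> (\<integral>s. exp (z * of_real s) * g s \<partial>M)"
    by (rule integral_dominated_convergence[OF meas _ int lim bound]) measurable
  moreover have "(\<integral>s. (\<Sum>i<n. ?t i s) \<partial>M) = (\<Sum>i<n. z ^ i / fact i * (\<integral>s. of_real s ^ i * g s \<partial>M))" for n
    by (subst Bochner_Integration.integral_sum[OF int_t]) simp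
  ultimately show "(\<lambda>n. z ^ n / fact n * (\<integral>s. of_real s ^ n * g s \<partial>M)) sums
           (\<integral>s. exp (z * of_real s) * g s \<partial>M)"
    by (simp add: sums_def)
qed

lemma Laplace_powr_real:
  assumes b: "Re b > 0" and w: "w > 0"
  shows "has_bochner_integral Mpos (\<lambda>s. of_real s powr (b - 1) * exp (- of_real (w * s)))
           (Gamma b * of_real w powr (- b))"
proof -
  let ?f = "\<lambda>t. complex_of_real t powr (b - 1) / of_real (exp t)"
  have "has_bochner_integral Mpos ?f (Gamma b)"
    using absolutely_integrable_Gamma_integral'[OF b] Gamma_integral_complex'[OF b]
    by (auto simp: has_bochner_integral_Mpos_iff)
  then have "has_bochner_integral Mpos (\<lambda>x. of_real w * ?f (w * x)) (Gamma b)"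
  proof (rule has_bochner_integral_Mpos_substitution)
    show "((*) w has_real_derivative w) (at x)" for x
      by (auto intro!: derivative_eq_intros)
    show "(*) w ` {0<..} = {0<..}"
    proof (intro equalityI subsetI)
      fix x :: real assume "x \<in> {0<..}"
      then show "x \<in> (*) w ` {0<..}" using w by (intro image_eqI[of _ _ "x / w"]) auto
    qed (use w in auto)
  qed (use w in \<open>auto simp: inj_on_def\<close>)
  note has_bochner_integral_mult_right[of "of_real w powr (- b)", OF this]
  then have "has_bochner_integral Mpos (\<lambda>x. of_real w powr (- b) * (of_real w * ?f (w * x))) (Gamma b * of_real w powr (- b))"
    by (simp add: mult.commute)
  then show ?thesis
  proof (rule has_bochner_integral_cong[THEN iffD1, rotated -1])
    fix x assume "x \<in> space Mpos"
    then have x: "x > 0" by simp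
    have "of_real w powr (- b) * (of_real w * ?f (w * x)) =
      (of_real w powr (- b) * of_real w powr (b - 1) * of_real w) * of_real x powr (b - 1) * exp (- of_real (w * x))"
    proof -
      have "complex_of_real (w * x) powr (b - 1) = of_real w powr (b - 1) * of_real x powr (b - 1)"
        using x w by (simp add: powr_times_real)
      moreover have "exp (- complex_of_real (w * x)) = inverse (of_real (exp (w * x)))"
        by (simp only: exp_minus exp_of_real)
      ultimately show ?thesis
        by (simp only: divide_inverse mult_ac)
    qed
    also have "of_real w powr (- b) * of_real w powr (b - 1) * of_real w = (1::complex)"
      using w by (simp add: powr_diff powr_minus field_simps)
    finally show "of_real w powr (- b) * (of_real w * ?f (w * x)) =
      of_real x powr (b - 1) * exp (- of_real (w * x))" by simp
  qed auto
qed

text \<open>For complex \<open>w\<close> expand \<open>exp (- w s)\<close> around a real point \<open>R\<close> so large that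
  \<open>norm (R - w) < R\<close>; the resulting series is the binomial one.\<close>

lemma Laplace_powr:
  assumes b: "Re b > 0" and w: "Re w > 0"
  shows "has_bochner_integral Mpos (\<lambda>s. of_real s powr (b - 1) * exp (- (w * of_real s)))
           (Gamma b * w powr (- b))"
proof -
  \<comment> \<open>The disc about R with 0 on its boundary contains w iff |w|^2 < 2 R Re w. The
    choice R Re w = |w|^2 is twice the threshold.\<close>
  define R where "R = (norm w)\<^sup>2 / Re w"
  have wnz: "w \<noteq> 0" using w by auto
  have R: "R > 0" using wnz w by (simp add: R_def)
  define z where "z = of_real R - w"
  have "(norm z)\<^sup>2 = R\<^sup>2 + (norm w)\<^sup>2 - 2 * R * Re w"
    by (simp add: z_def cmod_power2) (simp add: power2_eq_square algebra_simps)
  also have "R * Re w = (norm w)\<^sup>2" using w by (simp add: R_def)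
  then have "R\<^sup>2 + (norm w)\<^sup>2 - 2 * R * Re w < R\<^sup>2" using wnz by (simp add: mult.assoc)
  finally have zR: "norm z < R" using R by (simp add: power_less_imp_less_base)
  define g where "g = (\<lambda>s. complex_of_real s powr (b - 1) * exp (- of_real (R * s)))"
  have g_meas: "g \<in> borel_measurable Mpos"
    unfolding g_def by (intro borel_measurable_Mpos_continuous continuous_intros) auto
  have id_meas: "(\<lambda>s. s) \<in> borel_measurable Mpos"
    by (intro borel_measurable_Mpos_continuous continuous_intros)
  have moment: "has_bochner_integral Mpos (\<lambda>s. of_real s ^ n * g s)
      (Gamma b * pochhammer b n * of_real R powr (- b) / of_real R ^ n)" for n
  proof -
    have "b \<notin> \<int>\<^sub>\<le>\<^sub>0" using b by (auto elim!: nonpos_Ints_cases)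
    then have "Gamma (b + of_nat n) * of_real R powr (- (b + of_nat n)) =
        Gamma b * pochhammer b n * of_real R powr (- b) / of_real R ^ n"
      using R by (simp add: pochhammer_Gamma Gamma_eq_zero_iff powr_diff powr_minus powr_add field_simps)
    moreover have "has_bochner_integral Mpos (\<lambda>s. of_real s powr (b + of_nat n - 1) * exp (- of_real (R * s)))
         (Gamma (b + of_nat n) * of_real R powr (- (b + of_nat n)))"
      using b R by (intro Laplace_powr_real) auto
    ultimately have "has_bochner_integral Mpos (\<lambda>s. of_real s powr (b + of_nat n - 1) * exp (- of_real (R * s)))
       (Gamma b * pochhammer b n * of_real R powr (- b) / of_real R ^ n)" by simp
    then show ?thesis
    proof (rule has_bochner_integral_cong[THEN iffD1, rotated -1])
      fix s assume "s \<in> space Mpos"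
      then have s: "s > 0" by simp
      then have "complex_of_real s powr (b + of_nat n - 1) = of_real s ^ n * of_real s powr (b - 1)"
        by (simp add: powr_diff powr_add)
      then show "of_real s powr (b + of_nat n - 1) * exp (- of_real (R * s)) = of_real s ^ n * g s"
        by (simp add: g_def)
    qed auto
  qed
  \<comment> \<open>Absorbing exp(|z| s) into the weight leaves the decay rate R - |z|, which is
    still positive.\<close>
  have "integrable Mpos (\<lambda>s. norm (of_real s powr (b - 1) * exp (- of_real ((R - norm z) * s)) :: complex))"
    using Laplace_powr_real[OF b, of "R - norm z"] zR
    by (intro integrable_norm) (simp add: has_bochner_integral_iff)
  also have "?this \<longleftrightarrow> integrable Mpos (\<lambda>s. exp (norm z * \<bar>s\<bar>) * norm (g s))"
    by (intro Bochner_Integration.integrable_cong refl)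
      (auto simp: g_def norm_mult exp_add[symmetric] algebra_simps)
  finally have int: "integrable Mpos (\<lambda>s. exp (norm z * \<bar>s\<bar>) * norm (g s))" .
  note exch = integral_exp_mult_sums[OF g_meas id_meas int order.refl]
  have "(\<lambda>n. z ^ n / fact n * (\<integral>s. of_real s ^ n * g s \<partial>Mpos)) =
        (\<lambda>n. Gamma b * of_real R powr (- b) * ((- b gchoose n) * (- z / of_real R) ^ n))"
  proof
    fix n
    have "(- z / of_real R) ^ n = (-1) ^ n * (z ^ n / of_real R ^ n)"
      by (metis minus_divide_left power_divide power_minus)
    moreover have "(-1) ^ n * (-1) ^ n = (1 :: complex)"
      by (simp flip: power_mult_distrib)
    ultimately have "(- b gchoose n) * (- z / of_real R) ^ n = pochhammer b n / fact n * (z ^ n / of_real R ^ n)"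
      by (simp add: gbinomial_pochhammer)
    then show "z ^ n / fact n * (\<integral>s. of_real s ^ n * g s \<partial>Mpos) =
        Gamma b * of_real R powr (- b) * ((- b gchoose n) * (- z / of_real R) ^ n)"
      by (simp add: has_bochner_integral_integral_eq[OF moment])
  qed
  moreover have "(\<lambda>n. Gamma b * of_real R powr (- b) * ((- b gchoose n) * (- z / of_real R) ^ n)) sums
       (Gamma b * of_real R powr (- b) * (1 + (- z / of_real R)) powr (- b))"
    using zR R by (intro sums_mult gen_binomial_complex) (simp add: norm_divide)
  ultimately have "(\<integral>s. exp (z * of_real s) * g s \<partial>Mpos) =
       Gamma b * of_real R powr (- b) * (1 + (- z / of_real R)) powr (- b)"
    using exch(2) by (simp add: sums_iff)
  \<comment> \<open>R is positive, so multiplying by it leaves the argument unchanged and the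
    principal powers multiply.\<close>
  also have "\<dots> = Gamma b * (of_real R * (1 + (- z / of_real R))) powr (- b)"
    using R by (subst powr_times_real_left) auto
  also have "of_real R * (1 + (- z / of_real R)) = w"
    using R by (simp add: z_def field_simps)
  finally have "has_bochner_integral Mpos (\<lambda>s. exp (z * of_real s) * g s) (Gamma b * w powr (- b))"
    using exch(1) by (simp add: has_bochner_integral_iff)
  moreover have "(\<lambda>s. exp (z * of_real s) * g s) = (\<lambda>s. of_real s powr (b - 1) * exp (- (w * of_real s)))"
    by (auto simp: g_def z_def exp_diff exp_minus field_simps exp_add[symmetric])
  ultimately show ?thesis by simp
qed

text \<open>Substituting u = s^2 reduces this to \<open>Laplace_powr\<close> with exponent c/2 and
  rate p/2. A complex p is what turning the ray produces: the square of s e^(i \<theta>) is s^2 e^(2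
  i \<theta>).\<close>

lemma Gauss_moment:
  assumes c: "Re c > 0" and p: "Re p > 0"
  shows "has_bochner_integral Mpos (\<lambda>s. of_real s powr (c - 1) * exp (- (p * of_real s ^ 2 / 2)))
           (Gamma (c / 2) * (p / 2) powr (- c / 2) / 2)"
proof -
  let ?f = "\<lambda>u. complex_of_real u powr (c / 2 - 1) * exp (- (p / 2 * of_real u))"
  have "has_bochner_integral Mpos ?f (Gamma (c / 2) * (p / 2) powr (- (c / 2)))"
    by (rule Laplace_powr) (use c p in auto)
  then have "has_bochner_integral Mpos (\<lambda>x. of_real (2 * x) * ?f (x ^ 2))
      (Gamma (c / 2) * (p / 2) powr (- (c / 2)))"
  proof (rule has_bochner_integral_Mpos_substitution)
    show "((\<lambda>x. x\<^sup>2) has_real_derivative 2 * x) (at x)" for x :: real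
      by (auto intro!: derivative_eq_intros)
    show "inj_on (\<lambda>x::real. x\<^sup>2) {0<..}"
      by (auto simp: inj_on_def)
    show "(\<lambda>x::real. x\<^sup>2) ` {0<..} = {0<..}"
    proof (intro equalityI subsetI)
      fix x :: real assume "x \<in> {0<..}"
      then show "x \<in> (\<lambda>x. x\<^sup>2) ` {0<..}" by (intro image_eqI[of _ _ "sqrt x"]) auto
    qed auto
  qed auto
  then have "has_bochner_integral Mpos (\<lambda>x. (of_real (2 * x) * ?f (x ^ 2)) / 2)
      (Gamma (c / 2) * (p / 2) powr (- (c / 2)) / 2)"
    by (intro has_bochner_integral_divide_zero) auto
  then have "has_bochner_integral Mpos (\<lambda>x. (of_real (2 * x) * ?f (x ^ 2)) / 2)
      (Gamma (c / 2) * (p / 2) powr (- c / 2) / 2)"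
    by simp
  then show ?thesis
  proof (rule has_bochner_integral_cong[THEN iffD1, rotated -1])
    fix s assume "s \<in> space Mpos"
    then have s: "s > 0" by simp
    have "complex_of_real (s ^ 2) powr (c / 2 - 1) = exp ((c / 2 - 1) * (2 * of_real (ln s)))"
      using s by (simp add: powr_def Ln_of_real ln_realpow flip: of_real_power)
    also have "\<dots> = exp ((c - 1) * of_real (ln s)) / exp (of_real (ln s))"
      by (simp add: exp_diff[symmetric] algebra_simps)
    also have "exp (of_real (ln s)) = complex_of_real s"
      using s by (simp add: exp_of_real)
    also have "exp ((c - 1) * of_real (ln s)) = of_real s powr (c - 1)"
      using s by (simp add: powr_def Ln_of_real)
    finally show "(of_real (2 * s) * ?f (s ^ 2)) / 2 =
      of_real s powr (c - 1) * exp (- (p * of_real s ^ 2 / 2))"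
      using s by (simp add: field_simps)
  qed auto
qed

section \<open>The function U\<close>

text \<open>By \<open>Gauss_moment\<close> with c = b + n and p = 1, the bracket is the integral of
  s^(b+n-1) exp(-s^2/2); the sign and the factorial come from expanding exp(-z s) under the
  integral.\<close>

definition weber_coeff :: "complex \<Rightarrow> nat \<Rightarrow> complex" where
  "weber_coeff b n = (-1) ^ n / fact n * (2 powr ((b + of_nat n) / 2 - 1) * Gamma ((b + of_nat n) / 2))"

definition weber_series :: "complex \<Rightarrow> complex \<Rightarrow> complex" where
  "weber_series b z = (\<Sum>n. weber_coeff b n * z ^ n)"

text \<open>The integral over the ray of angle \<open>\<theta>\<close> does not depend on \<open>\<theta>\<close>, because its Taylor
  coefficients at \<open>z = 0\<close> do not.\<close>

lemma weber_series_integral: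
  assumes b: "Re b > 0" and \<theta>: "\<bar>\<theta>\<bar> < pi / 4"
  shows "has_bochner_integral Mpos
      (\<lambda>s. exp (- (z * cis \<theta> * of_real s)) * (of_real s powr (b - 1) * exp (- (cis (2 * \<theta>) * of_real s ^ 2 / 2))))
      (exp (- (\<i> * of_real \<theta> * b)) * weber_series b z)"
    and "(\<lambda>n. weber_coeff b n * z ^ n) sums weber_series b z"
proof -
  define g where "g = (\<lambda>s. complex_of_real s powr (b - 1) * exp (- (cis (2 * \<theta>) * of_real s ^ 2 / 2)))"
  define q where "q = cos (2 * \<theta>)"
  have q: "q > 0"
    unfolding q_def by (rule cos_gt_zero_pi) (use \<theta> in auto)
  define r where "r = norm z"
  have g_meas: "g \<in> borel_measurable Mpos"
    unfolding g_def by (intro borel_measurable_Mpos_continuous continuous_intros) auto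
  have id_meas: "(\<lambda>s. s) \<in> borel_measurable Mpos"
    by (intro borel_measurable_Mpos_continuous continuous_intros)
  have int: "integrable Mpos (\<lambda>s. exp (r * \<bar>s\<bar>) * norm (g s))"
  proof (rule Bochner_Integration.integrable_bound)
    have "has_bochner_integral Mpos (\<lambda>s. of_real s powr (b - 1) * exp (- (of_real (q / 2) * of_real s ^ 2 / 2)))
           (Gamma (b / 2) * (of_real (q / 2) / 2) powr (- b / 2) / 2)"
      by (intro Gauss_moment) (use b q in auto)
    then show "integrable Mpos (\<lambda>s. of_real (exp (r\<^sup>2 / q)) * (of_real s powr (b - 1) * exp (- (of_real (q / 2) * of_real s ^ 2 / 2))) :: complex)"
      by (intro integrable_mult_right) (auto simp: has_bochner_integral_iff)
    show "(\<lambda>s. exp (r * \<bar>s\<bar>) * norm (g s)) \<in> borel_measurable Mpos"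
      using g_meas id_meas by measurable
    show "AE s in Mpos. norm (exp (r * \<bar>s\<bar>) * norm (g s)) \<le>
       norm (of_real (exp (r\<^sup>2 / q)) * (of_real s powr (b - 1) * exp (- (of_real (q / 2) * of_real s ^ 2 / 2))) :: complex)"
    proof (intro AE_I2)
      fix s assume "s \<in> space Mpos"
      then have s: "s > 0" by simp
      \<comment> \<open>Half of the Gaussian pays for exp(r s): completing the square bounds r s by
        r^2/q + q s^2/4, and exp(-q s^2/4) remains, the weight of \<open>Gauss_moment\<close> with p
        = q/2.\<close>
      have "0 \<le> (q * s / 2 - r)\<^sup>2 / q" using q by simp
      also have "\<dots> = q * s\<^sup>2 / 4 - r * s + r\<^sup>2 / q" using q by (simp add: power2_eq_square field_simps)
      finally have le: "r * s - q * s\<^sup>2 / 2 \<le> r\<^sup>2 / q - q * s\<^sup>2 / 4" by simp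
      have "norm (exp (r * \<bar>s\<bar>) * norm (g s)) = norm (of_real s powr (b - 1) :: complex) * exp (r * s - q * s\<^sup>2 / 2)"
      proof -
        have "norm (g s) = norm (of_real s powr (b - 1) :: complex) * exp (- (q * s\<^sup>2 / 2))"
          by (simp add: g_def norm_mult q_def flip: of_real_power)
        then show ?thesis using s by (simp add: exp_add[symmetric] mult_ac diff_conv_add_uminus del: add_uminus_conv_diff)
      qed
      also have "\<dots> \<le> norm (of_real s powr (b - 1) :: complex) * exp (r\<^sup>2 / q - q * s\<^sup>2 / 4)"
        using le by (intro mult_left_mono) auto
      also have "\<dots> = norm (of_real (exp (r\<^sup>2 / q)) * (of_real s powr (b - 1) * exp (- (of_real (q / 2) * of_real s ^ 2 / 2))) :: complex)"
      proof -
        have "norm (of_real (exp (r\<^sup>2 / q)) * (of_real s powr (b - 1) * exp (- (of_real (q / 2) * of_real s ^ 2 / 2))) :: complex)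
          = exp (r\<^sup>2 / q) * (norm (of_real s powr (b - 1) :: complex) * exp (- (q * s\<^sup>2 / 4)))"
          by (simp add: norm_mult flip: of_real_power)
        then show ?thesis by (simp add: exp_add[symmetric] mult_ac diff_conv_add_uminus del: add_uminus_conv_diff)
      qed
      finally show "norm (exp (r * \<bar>s\<bar>) * norm (g s)) \<le> norm (of_real (exp (r\<^sup>2 / q)) * (of_real s powr (b - 1) * exp (- (of_real (q / 2) * of_real s ^ 2 / 2))) :: complex)" .
    qed
  qed
  define w where "w = - (z * cis \<theta>)"
  have w: "norm w \<le> r" by (simp add: w_def r_def norm_mult)
  note exch = integral_exp_mult_sums[OF g_meas id_meas int w]
  have moment: "w ^ n / fact n * (\<integral>s. of_real s ^ n * g s \<partial>Mpos) =
      exp (- (\<i> * of_real \<theta> * b)) * (weber_coeff b n * z ^ n)" for n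
  proof -
    let ?c = "b + of_nat n"
    have "has_bochner_integral Mpos (\<lambda>s. of_real s powr (?c - 1) * exp (- (cis (2 * \<theta>) * of_real s ^ 2 / 2)))
           (Gamma (?c / 2) * (cis (2 * \<theta>) / 2) powr (- ?c / 2) / 2)"
      by (intro Gauss_moment) (use b q in \<open>auto simp: q_def\<close>)
    then have "has_bochner_integral Mpos (\<lambda>s. of_real s ^ n * g s)
           (Gamma (?c / 2) * (cis (2 * \<theta>) / 2) powr (- ?c / 2) / 2)"
    proof (rule has_bochner_integral_cong[THEN iffD1, rotated -1])
      fix s assume "s \<in> space Mpos"
      then have s: "s > 0" by simp
      then have "complex_of_real s powr (?c - 1) = of_real s ^ n * of_real s powr (b - 1)"
        by (simp add: powr_diff powr_add)
      then show "of_real s powr (?c - 1) * exp (- (cis (2 * \<theta>) * of_real s ^ 2 / 2)) = of_real s ^ n * g s"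
        by (simp add: g_def)
    qed auto
    then have eq: "(\<integral>s. of_real s ^ n * g s \<partial>Mpos) = Gamma (?c / 2) * (cis (2 * \<theta>) / 2) powr (- ?c / 2) / 2"
      by (rule has_bochner_integral_integral_eq)
    \<comment> \<open>As 2 \<theta> is within (-\<pi>/2, \<pi>/2), the principal power splits
      exactly. Its factor e^(-i \<theta> n) cancels the (cis \<theta>)^n coming from w^n, so
      \<theta> survives only in the common factor e^(-i \<theta> b).\<close>
    have "Ln (cis (2 * \<theta>) / 2) = - of_real (ln 2) + 2 * \<i> * of_real \<theta>"
    proof (rule Ln_unique)
      have "exp (complex_of_real (ln 2)) = 2"
        unfolding exp_of_real by simp
      then show "exp (- complex_of_real (ln 2) + 2 * \<i> * of_real \<theta>) = cis (2 * \<theta>) / 2"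
        by (simp add: exp_diff cis_conv_exp mult_ac)
    qed (use \<theta> in auto)
    then have "(cis (2 * \<theta>) / 2) powr (- ?c / 2) = exp (- ?c / 2 * (- of_real (ln 2) + 2 * \<i> * of_real \<theta>))"
      by (simp add: powr_def)
    also have "\<dots> = exp (- (\<i> * of_real \<theta> * b)) * exp (- (\<i> * of_real \<theta> * of_nat n)) * exp (?c / 2 * of_real (ln 2))"
      by (simp add: field_simps flip: exp_add)
    also have "exp (?c / 2 * of_real (ln 2)) = 2 * 2 powr (?c / 2 - 1)"
      by (simp add: powr_diff) (simp add: powr_def Ln_of_real[of 2, simplified])
    also have "exp (- (\<i> * of_real \<theta> * of_nat n)) = inverse (cis \<theta> ^ n)"
      by (simp add: cis_conv_exp exp_minus mult_ac flip: exp_of_nat_mult)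
    finally show ?thesis
      unfolding eq weber_coeff_def w_def
      by (simp add: power_minus[of "z * cis \<theta>"] power_mult_distrib field_simps)
  qed
  have sums: "(\<lambda>n. exp (- (\<i> * of_real \<theta> * b)) * (weber_coeff b n * z ^ n)) sums
         (\<integral>s. exp (w * of_real s) * g s \<partial>Mpos)"
    using exch(2) unfolding moment .
  then have "summable (\<lambda>n. weber_coeff b n * z ^ n)"
    using sums_summable summable_cmult_iff by fastforce
  then show sums': "(\<lambda>n. weber_coeff b n * z ^ n) sums weber_series b z"
    unfolding weber_series_def by (rule summable_sums)
  have "(\<integral>s. exp (w * of_real s) * g s \<partial>Mpos) = exp (- (\<i> * of_real \<theta> * b)) * weber_series b z"
    using sums_unique2[OF sums sums_mult[OF sums']] .
  then show "has_bochner_integral Mpos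
      (\<lambda>s. exp (- (z * cis \<theta> * of_real s)) * (of_real s powr (b - 1) * exp (- (cis (2 * \<theta>) * of_real s ^ 2 / 2))))
      (exp (- (\<i> * of_real \<theta> * b)) * weber_series b z)"
    using exch(1) by (simp add: has_bochner_integral_iff g_def w_def)
qed

section \<open>Leading asymptotics of the integral in sectors\<close>

text \<open>On the closed left half-plane, a convex set, the derivative of exp has norm at most 1;
  the mean value inequality between 0 and z applies.\<close>

lemma norm_exp_minus_1_le:
  fixes z :: complex
  assumes "Re z \<le> 0"
  shows "norm (exp z - 1) \<le> norm z"
proof -
  have "norm (exp z - exp 0) \<le> 1 * norm (z - 0)"
    by (rule field_differentiable_bound[where S = "{z. Re z \<le> 0}" and f' = exp])
      (use assms in \<open>auto intro!: derivative_eq_intros convex_halfspace_Re_le\<close>)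
  then show ?thesis by simp
qed

text \<open>Replacing the Gaussian factor by 1 leaves a Laplace integral with value \<Gamma>(b)
  w^(-b), w = z cis \<theta>. Since the coefficient cis(2 \<theta>) has modulus 1 and positive real
  part, the replacement costs at most s^2/2 pointwise, which raises the exponent of s by 2 in the
  error integral.\<close>

lemma weber_series_error:
  assumes b: "Re b > 0" and \<theta>: "\<bar>\<theta>\<bar> < pi / 4" and w: "Re (z * cis \<theta>) > 0"
  shows "norm (exp (- (\<i> * of_real \<theta> * b)) * weber_series b z - Gamma b * (z * cis \<theta>) powr (- b))
     \<le> norm (Gamma (of_real (Re b + 2)) :: complex) * Re (z * cis \<theta>) powr (- Re b - 2) / 2"
proof -
  define w where "w = z * cis \<theta>"
  let ?p = "cis (2 * \<theta>)"
  let ?F = "\<lambda>s. exp (- (w * of_real s)) * (of_real s powr (b - 1) * exp (- (?p * of_real s ^ 2 / 2)))"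
  let ?G = "\<lambda>s. of_real s powr (b - 1) * exp (- (w * of_real s)) :: complex"
  let ?H = "\<lambda>s. of_real s powr (of_real (Re b + 2) - 1) * exp (- (of_real (Re w) * of_real s)) :: complex"
  have w0: "Re w > 0" using assms by (simp add: w_def)
  have diff: "has_bochner_integral Mpos (\<lambda>s. ?F s - ?G s)
     (exp (- (\<i> * of_real \<theta> * b)) * weber_series b z - Gamma b * w powr (- b))"
    by (intro has_bochner_integral_diff Laplace_powr weber_series_integral(1)[OF b \<theta>, of z, folded w_def] b w0)
  have H: "has_bochner_integral Mpos ?H (Gamma (of_real (Re b + 2)) * of_real (Re w) powr (- of_real (Re b + 2)))"
    by (intro Laplace_powr) (use b w0 in auto)
  have cos: "cos (2 * \<theta>) > 0"
    by (rule cos_gt_zero_pi) (use \<theta> in auto)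
  have "norm (\<integral>s. ?F s - ?G s \<partial>Mpos) \<le> (\<integral>s. Re (?H s) / 2 \<partial>Mpos)"
  proof (rule Bochner_Integration.integral_norm_bound_integral)
    show "integrable Mpos (\<lambda>s. ?F s - ?G s)"
      using diff by (simp add: has_bochner_integral_iff)
    show "integrable Mpos (\<lambda>s. Re (?H s) / 2)"
      using H by (intro Bochner_Integration.integrable_divide integrable_Re) (simp add: has_bochner_integral_iff)
    fix s assume "s \<in> space Mpos"
    then have s: "s > 0" by simp
    have "norm (?F s - ?G s) = norm (?G s) * norm (exp (- (?p * of_real s ^ 2 / 2)) - 1)"
      by (simp add: algebra_simps flip: norm_mult)
    also have "\<dots> \<le> norm (?G s) * norm (- (?p * of_real s ^ 2 / 2))"
      using cos by (intro mult_left_mono norm_exp_minus_1_le) (auto simp flip: of_real_power)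
    also have "\<dots> = s powr (Re b - 1) * s\<^sup>2 * exp (- (Re w * s)) / 2"
      using s by (simp add: norm_mult norm_powr_real_powr norm_power norm_divide)
    also have "s powr (Re b - 1) * s\<^sup>2 = s powr (Re b + 1)"
      using s by (simp add: powr_add[symmetric] powr_numeral[symmetric] algebra_simps del: powr_numeral)
    also have "s powr (Re b + 1) * exp (- (Re w * s)) / 2 = Re (?H s) / 2"
    proof -
      have "?H s = of_real (s powr (Re b + 1) * exp (- (Re w * s)))"
        using s by (simp add: powr_of_real[symmetric] exp_of_real[symmetric] algebra_simps)
      then show ?thesis by (simp only: Re_complex_of_real)
    qed
    finally show "norm (?F s - ?G s) \<le> Re (?H s) / 2" .
  qed
  also have "(\<integral>s. Re (?H s) / 2 \<partial>Mpos) = Re (\<integral>s. ?H s \<partial>Mpos) / 2"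
    using H unfolding has_bochner_integral_iff
    by (subst Bochner_Integration.integral_divide_zero, subst integral_Re) auto
  also have "\<dots> \<le> norm (\<integral>s. ?H s \<partial>Mpos) / 2"
    by (simp add: complex_Re_le_cmod)
  also have "(\<integral>s. ?H s \<partial>Mpos) = Gamma (of_real (Re b + 2)) * of_real (Re w) powr (- of_real (Re b + 2))"
    using H by (rule has_bochner_integral_integral_eq)
  also have "norm \<dots> = norm (Gamma (of_real (Re b + 2)) :: complex) * Re w powr (- Re b - 2)"
    using w0 by (simp add: norm_mult norm_powr_real_powr)
  also have "(\<integral>s. ?F s - ?G s \<partial>Mpos) = exp (- (\<i> * of_real \<theta> * b)) * weber_series b z - Gamma b * w powr (- b)"
    using diff by (rule has_bochner_integral_integral_eq)
  finally show ?thesis by (simp add: w_def)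
qed

text \<open>The condition keeps w = z cis \<theta> in a closed sector inside the right half-plane,
  so Re w is comparable to |z| and the error of \<open>weber_series_error\<close> is of order
  |z|^(-2) relative to the main term.\<close>

lemma weber_series_asymp_ray:
  assumes b: "Re b > 0" and \<theta>: "\<bar>\<theta>\<bar> < pi / 4" and \<beta>: "0 \<le> \<beta>" "\<beta> < pi / 2"
  obtains K where "K \<ge> 0"
    "\<And>z. z \<noteq> 0 \<Longrightarrow> \<bar>Arg z + \<theta>\<bar> \<le> \<beta> \<Longrightarrow>
       norm (weber_series b z / (Gamma b * z powr (- b)) - 1) \<le> K / norm z ^ 2"
proof -
  define \<kappa> where "\<kappa> = cos \<beta>"
  have \<kappa>: "\<kappa> > 0" unfolding \<kappa>_def using \<beta> by (intro cos_gt_zero_pi) auto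
  have Gnz: "Gamma b \<noteq> 0" using b by (auto simp: Gamma_eq_zero_iff elim!: nonpos_Ints_cases)
  define C where "C = norm (Gamma (of_real (Re b + 2)) :: complex) / 2"
  \<comment> \<open>\<kappa> is the lower bound for Re w / |z|; exp(|Im b| \<pi>) accounts for the
    dependence of |w^(-b)| on the argument of w.\<close>
  define K where "K = C * \<kappa> powr (- Re b - 2) * exp (\<bar>Im b\<bar> * pi) / norm (Gamma b)"
  have "K \<ge> 0" by (simp add: K_def C_def)
  moreover have "norm (weber_series b z / (Gamma b * z powr (- b)) - 1) \<le> K / norm z ^ 2"
    if z: "z \<noteq> 0" and arg: "\<bar>Arg z + \<theta>\<bar> \<le> \<beta>" for z
  proof -
    define w where "w = z * cis \<theta>"
    have Arg_cis: "Arg (cis \<theta>) = \<theta>" using \<theta> by (intro Arg_cis) auto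
    have Argw: "Arg w = Arg z + \<theta>"
      unfolding w_def using z arg \<beta> by (subst Arg_times) (auto simp: Arg_cis abs_le_iff)
    have nw: "norm w = norm z" by (simp add: w_def norm_mult)
    have wnz: "w \<noteq> 0" using z by (simp add: w_def)
    have "Re w = norm w * cos (Arg w)"
      using wnz by (metis rcis_cmod_Arg Re_rcis)
    also have "cos (Arg w) = cos \<bar>Arg z + \<theta>\<bar>" by (simp add: Argw)
    also have "norm w * \<dots> \<ge> norm z * \<kappa>"
      unfolding \<kappa>_def nw using arg \<beta> by (intro mult_left_mono cos_monotone_0_pi_le) auto
    finally have Rew: "Re w \<ge> norm z * \<kappa>" .
    have zk: "norm z * \<kappa> > 0" using z \<kappa> by simp
    define e where "e = exp (- (\<i> * of_real \<theta> * b))"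
    have powr_eq: "w powr (- b) = z powr (- b) * e"
    proof -
      \<comment> \<open>No branch is crossed, because Arg w = Arg z + \<theta> stays within
        (-\<pi>/2, \<pi>/2). So the prefactor e cancels exactly in the quotient.\<close>
      have "Ln w = Ln z + \<i> * of_real \<theta>"
        using wnz z Argw nw by (intro complex_eqI) (auto simp: Arg_eq_Im_Ln)
      then show ?thesis using z wnz by (simp add: powr_def e_def exp_add[symmetric] algebra_simps)
    qed
    have enz: "e \<noteq> 0" by (simp add: e_def)
    have znz: "z powr (- b) \<noteq> 0" using z by simp
    have "weber_series b z / (Gamma b * z powr (- b)) - 1 = (e * weber_series b z - Gamma b * w powr (- b)) / (Gamma b * w powr (- b))"
      using enz znz Gnz by (simp add: powr_eq field_simps)
    also have "norm \<dots> = norm (e * weber_series b z - Gamma b * w powr (- b)) / (norm (Gamma b) * norm (w powr (- b)))"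
      by (simp add: norm_divide norm_mult)
    also have "\<dots> \<le> (C * (norm z * \<kappa>) powr (- Re b - 2)) / (norm (Gamma b) * (norm z powr (- Re b) * exp (- (\<bar>Im b\<bar> * pi))))"
    proof (rule frac_le)
      have "norm (e * weber_series b z - Gamma b * w powr (- b)) \<le> C * Re w powr (- Re b - 2)"
        using weber_series_error[OF b \<theta>, of z, folded w_def] Rew zk unfolding e_def C_def by auto
      also have "\<dots> \<le> C * (norm z * \<kappa>) powr (- Re b - 2)"
        using Rew zk b by (intro mult_left_mono powr_mono2') (auto simp: C_def)
      finally show "norm (e * weber_series b z - Gamma b * w powr (- b)) \<le> C * (norm z * \<kappa>) powr (- Re b - 2)" .
      have "\<bar>Im b * Arg w\<bar> \<le> \<bar>Im b\<bar> * pi"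
        unfolding abs_mult Argw using arg \<beta> by (intro mult_left_mono) auto
      then have "- (\<bar>Im b\<bar> * pi) \<le> Im b * Arg w" by linarith
      then show "norm (Gamma b) * (norm z powr (- Re b) * exp (- (\<bar>Im b\<bar> * pi))) \<le> norm (Gamma b) * norm (w powr (- b))"
        by (auto simp: norm_powr_complex nw intro!: mult_left_mono)
      show "0 < norm (Gamma b) * (norm z powr (- Re b) * exp (- (\<bar>Im b\<bar> * pi)))"
        using Gnz z by simp
    qed (auto simp: C_def)
    also have "\<dots> = K / norm z ^ 2"
      using z \<kappa> Gnz by (simp add: K_def powr_mult powr_diff powr_minus exp_minus field_simps powr_numeral)
    finally show ?thesis .
  qed
  ultimately show ?thesis by (rule that)
qed

text \<open>Two rays share the sector: the one turned by -\<theta> serves Arg z \<ge> 0, the one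
  turned by \<theta> serves Arg z < 0. With \<theta> close to \<pi>/4, each reaches almost to
  3\<pi>/4.\<close>

lemma weber_series_asymp:
  assumes b: "Re b > 0" and \<delta>: "\<delta> > 0"
  shows "((\<lambda>z. weber_series b z / (Gamma b * z powr (- b))) \<longlongrightarrow> 1)
           (inf at_infinity (principal {z. \<bar>Arg z\<bar> \<le> 3 * pi / 4 - \<delta>}))"
proof -
  \<comment> \<open>Chosen so that \<theta> + \<beta> = 3\<pi>/4 - min(\<delta>, \<pi>/4), while
    \<beta> stays below \<pi>/2; the minimum keeps \<theta> positive for large \<delta>.\<close>
  define \<theta> where "\<theta> = pi / 4 - min \<delta> (pi / 4) / 2"
  have \<theta>: "0 < \<theta>" "\<theta> < pi / 4" using \<delta> by (auto simp: \<theta>_def min_def)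
  define \<beta> where "\<beta> = pi / 4 + \<theta>"
  have \<beta>: "0 \<le> \<beta>" "\<beta> < pi / 2" using \<theta> by (auto simp: \<beta>_def)
  have 1: "\<bar>\<theta>\<bar> < pi / 4" "\<bar>- \<theta>\<bar> < pi / 4" using \<theta> by auto
  obtain K1 where K1: "K1 \<ge> 0" "\<And>z. z \<noteq> 0 \<Longrightarrow> \<bar>Arg z + \<theta>\<bar> \<le> \<beta> \<Longrightarrow>
       norm (weber_series b z / (Gamma b * z powr (- b)) - 1) \<le> K1 / norm z ^ 2"
    using weber_series_asymp_ray[OF b 1(1) \<beta>] by blast
  obtain K2 where K2: "K2 \<ge> 0" "\<And>z. z \<noteq> 0 \<Longrightarrow> \<bar>Arg z + - \<theta>\<bar> \<le> \<beta> \<Longrightarrow>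
       norm (weber_series b z / (Gamma b * z powr (- b)) - 1) \<le> K2 / norm z ^ 2"
    using weber_series_asymp_ray[OF b 1(2) \<beta>] by blast
  let ?F = "inf at_infinity (principal {z. \<bar>Arg z\<bar> \<le> 3 * pi / 4 - \<delta>})"
  have "((\<lambda>z. (K1 + K2) / norm z ^ 2) \<longlongrightarrow> 0) (at_infinity :: complex filter)"
    by (intro real_tendsto_divide_at_top[OF tendsto_const]
        filterlim_compose[OF filterlim_pow_at_top filterlim_norm_at_top] filterlim_ident) auto
  then have lim: "((\<lambda>z. (K1 + K2) / norm z ^ 2) \<longlongrightarrow> 0) ?F"
    by (rule tendsto_mono[rotated]) simp
  have "eventually (\<lambda>z. z \<noteq> 0) (at_infinity :: complex filter)"
    using eventually_not_equal_at_infinity by blast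
  then have ev: "eventually (\<lambda>z. norm (weber_series b z / (Gamma b * z powr (- b)) - 1) \<le> (K1 + K2) / norm z ^ 2) ?F"
    unfolding eventually_inf_principal
  proof eventually_elim
    case (elim z)
    show ?case
    proof
      assume "z \<in> {z. \<bar>Arg z\<bar> \<le> 3 * pi / 4 - \<delta>}"
      then have z: "\<bar>Arg z\<bar> \<le> 3 * pi / 4 - \<delta>" by simp
      have le: "K1 / norm z ^ 2 \<le> (K1 + K2) / norm z ^ 2" "K2 / norm z ^ 2 \<le> (K1 + K2) / norm z ^ 2"
        using K1(1) K2(1) by (auto intro!: divide_right_mono)
      show "norm (weber_series b z / (Gamma b * z powr (- b)) - 1) \<le> (K1 + K2) / norm z ^ 2"
      proof (cases "Arg z \<ge> 0")
        case True
        then have "\<bar>Arg z + - \<theta>\<bar> \<le> \<beta>" using z \<delta> \<theta> pi_gt_zero unfolding \<beta>_def \<theta>_def min_def by (simp add: abs_le_iff split: if_splits)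
        from order_trans[OF K2(2)[OF elim this] le(2)] show ?thesis .
      next
        case False
        then have "\<bar>Arg z + \<theta>\<bar> \<le> \<beta>" using z \<delta> \<theta> pi_gt_zero unfolding \<beta>_def \<theta>_def min_def by (simp add: abs_le_iff split: if_splits)
        from order_trans[OF K1(2)[OF elim this] le(1)] show ?thesis .
      qed
    qed
  qed
  have "((\<lambda>z. weber_series b z / (Gamma b * z powr (- b)) - 1) \<longlongrightarrow> 0) ?F"
    using ev lim by (rule Lim_null_comparison)
  then show ?thesis by (simp add: LIM_zero_iff)
qed

section \<open>The Weber differential equation\<close>

definition weber_U :: "complex \<Rightarrow> complex \<Rightarrow> complex" where
  "weber_U a z = exp (- z\<^sup>2 / 4) * weber_series (a + 1/2) z / Gamma (a + 1/2)"

text \<open>The derivative is carried as a second function, so that initial data, linear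
  combinations and Wronskians can be written without \<open>deriv\<close>.\<close>

definition ode_sol :: "(complex \<Rightarrow> complex) \<Rightarrow> (complex \<Rightarrow> complex) \<Rightarrow> (complex \<Rightarrow> complex) \<Rightarrow> bool" where
  "ode_sol q f f1 \<longleftrightarrow> (\<forall>z. (f has_field_derivative f1 z) (at z) \<and>
                         (f1 has_field_derivative q z * f z) (at z))"

lemma ode_sol_lincomb:
  assumes "ode_sol q f f1" "ode_sol q g g1"
  shows "ode_sol q (\<lambda>z. c * f z + d * g z) (\<lambda>z. c * f1 z + d * g1 z)"
  using assms unfolding ode_sol_def
  by (auto intro!: derivative_eq_intros simp: algebra_simps)

lemma ode_sol_holomorphic:
  assumes "ode_sol q f f1"
  shows "f holomorphic_on S" "f1 holomorphic_on S"
  using assms unfolding ode_sol_def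
  by (metis DERIV_subset field_differentiable_def holomorphic_on_def subset_UNIV)+

lemma ode_sol_deriv:
  assumes "ode_sol q f f1"
  shows "deriv f = f1" "deriv f1 = (\<lambda>z. q z * f z)"
  using assms unfolding ode_sol_def by (auto intro!: DERIV_imp_deriv ext)

text \<open>Differentiating the equation by the Leibniz rule expresses each derivative at z0 through
  lower ones, so all vanish by strong induction; the identity theorem finishes.\<close>

lemma ode_sol_eq_0:
  assumes f: "ode_sol q f f1" and q: "q holomorphic_on UNIV"
    and init: "f z0 = 0" "f1 z0 = 0"
  shows "f z = 0"
proof (rule holomorphic_fun_eq_0_on_connected[of f UNIV z0])
  note hol = ode_sol_holomorphic(1)[OF f]
  fix n show "(deriv ^^ n) f z0 = 0"
  proof (induction n rule: less_induct)
    case (less n)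
    consider "n = 0" | "n = 1" | m where "n = Suc (Suc m)"
      by (metis One_nat_def not0_implies_Suc)
    then show ?case
    proof cases
      case 3
      have "(deriv ^^ n) f z0 = (deriv ^^ m) (deriv (deriv f)) z0"
        by (simp add: 3 funpow_swap1)
      also have "deriv (deriv f) = (\<lambda>z. q z * f z)"
        by (simp add: ode_sol_deriv[OF f])
      also have "(deriv ^^ m) \<dots> z0 = (\<Sum>i = 0..m. of_nat (m choose i) * (deriv ^^ i) q z0 * (deriv ^^ (m - i)) f z0)"
        using q hol by (intro higher_deriv_mult[of _ UNIV]) auto
      also have "\<dots> = 0"
        by (intro sum.neutral ballI) (simp add: less 3)
      finally show ?thesis .
    qed (use init in \<open>auto simp: ode_sol_deriv[OF f]\<close>)
  qed
qed (use ode_sol_holomorphic(1)[OF f] in auto)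

lemma ode_sol_Wronskian_const:
  assumes "ode_sol q f f1" "ode_sol q g g1"
  shows "f z * g1 z - f1 z * g z = f w * g1 w - f1 w * g w"
proof -
  have "\<exists>c. \<forall>z\<in>UNIV. f z * g1 z - f1 z * g z = c"
  proof (rule has_field_derivative_zero_constant)
    fix z :: complex
    show "((\<lambda>z. f z * g1 z - f1 z * g z) has_field_derivative 0) (at z within UNIV)"
      using assms unfolding ode_sol_def
      by (auto intro!: derivative_eq_intros)
  qed auto
  then show ?thesis by auto
qed

text \<open>Raising n by 2 raises the argument of Gamma by 1, so the functional equation applies. In
  terms of the series g this is g'' = z g' + b g.\<close>

lemma weber_coeff_Suc_Suc:
  assumes b: "Re b > 0"
  shows "of_nat (Suc (Suc n)) * of_nat (Suc n) * weber_coeff b (Suc (Suc n)) = (of_nat n + b) * weber_coeff b n"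
proof -
  have "(b + of_nat n) / 2 \<notin> \<int>\<^sub>\<le>\<^sub>0"
    using b by (auto elim!: nonpos_Ints_cases dest: arg_cong[of _ _ Re])
  then have G: "Gamma ((b + of_nat n) / 2 + 1) = (b + of_nat n) / 2 * Gamma ((b + of_nat n) / 2)"
    by (rule Gamma_plus1)
  have e: "(b + of_nat (Suc (Suc n))) / 2 = (b + of_nat n) / 2 + 1"
    by (simp add: field_simps)
  define N where "N = (of_nat (Suc (Suc n)) * of_nat (Suc n) :: complex)"
  have N: "N \<noteq> 0" unfolding N_def by (simp del: of_nat_Suc)
  have "weber_coeff b (Suc (Suc n)) = (-1) ^ n / fact (Suc (Suc n)) * ((b + of_nat n) * (2 powr ((b + of_nat n) / 2 - 1) * Gamma ((b + of_nat n) / 2)))"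
    unfolding weber_coeff_def e G by (simp add: powr_diff del: fact_Suc)
  moreover have "(fact (Suc (Suc n)) :: complex) = N * fact n"
    by (simp only: fact_Suc mult.assoc of_nat_mult N_def)
  ultimately have "N * weber_coeff b (Suc (Suc n)) = (b + of_nat n) * weber_coeff b n"
    using N unfolding weber_coeff_def by (simp del: fact_Suc of_nat_Suc)
  then show ?thesis by (simp only: N_def add.commute)
qed

lemma weber_series_ode:
  assumes b: "Re b > 0"
  obtains g1 where "\<And>z. (weber_series b has_field_derivative g1 z) (at z)"
    "\<And>z. (g1 has_field_derivative (z * g1 z + b * weber_series b z)) (at z)"
    "weber_series b 0 = weber_coeff b 0" "g1 0 = weber_coeff b 1"
proof -
  let ?c = "weber_coeff b"
  have sums: "(\<lambda>n. ?c n * z ^ n) sums weber_series b z" for z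
    by (rule weber_series_integral(2)[OF b, of 0]) auto
  then have sm: "summable (\<lambda>n. ?c n * z ^ n)" for z by (rule sums_summable)
  note sm1 = termdiff_converges_all[OF sm]
  define g1 where "g1 = (\<lambda>z. \<Sum>n. diffs ?c n * z ^ n)"
  have d1: "(weber_series b has_field_derivative g1 z) (at z)" for z
    using termdiffs_strong_converges_everywhere[OF sm] by (simp add: weber_series_def[abs_def] g1_def)
  have d2: "(g1 has_field_derivative (\<Sum>n. diffs (diffs ?c) n * z ^ n)) (at z)" for z
    using termdiffs_strong_converges_everywhere[OF sm1] by (simp add: g1_def)
  have rec: "diffs (diffs ?c) n = of_nat n * ?c n + b * ?c n" for n
    using weber_coeff_Suc_Suc[OF b, of n] by (simp add: diffs_def algebra_simps)
  have zg1: "(\<lambda>n. of_nat n * ?c n * z ^ n) sums (z * g1 z)" for z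
  proof -
    have "(\<lambda>n. diffs ?c n * z ^ n * z) sums (g1 z * z)"
      unfolding g1_def by (intro sums_mult2 summable_sums sm1)
    then have "(\<lambda>n. of_nat (Suc n) * ?c (Suc n) * z ^ Suc n) sums (z * g1 z)"
      by (simp add: diffs_def mult_ac)
    then show ?thesis by (subst (asm) sums_Suc_iff) simp
  qed
  have "(\<lambda>n. of_nat n * ?c n * z ^ n + b * (?c n * z ^ n)) sums (z * g1 z + b * weber_series b z)" for z
    by (intro sums_add zg1 sums_mult sums)
  then have "(\<lambda>n. diffs (diffs ?c) n * z ^ n) sums (z * g1 z + b * weber_series b z)" for z
    by (simp add: rec algebra_simps)
  then have "(\<Sum>n. diffs (diffs ?c) n * z ^ n) = z * g1 z + b * weber_series b z" for z
    by (rule sums_unique[symmetric])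
  with d2 have d2': "(g1 has_field_derivative (z * g1 z + b * weber_series b z)) (at z)" for z by simp
  have "weber_series b 0 = ?c 0" by (simp add: weber_series_def powser_zero)
  moreover have "g1 0 = ?c 1" by (simp add: g1_def powser_zero diffs_def)
  ultimately show ?thesis using that d1 d2' by blast
qed

text \<open>The factor exp(-z^2/4) removes the first-order term of g'' = z g' + b g and shifts the
  constant from b to b - 1/2 = a. The data at 0 are recorded for the connection formula.\<close>

lemma weber_U_ode:
  assumes a: "Re a > -1/2"
  obtains U1 where "ode_sol (\<lambda>z. z\<^sup>2 / 4 + a) (weber_U a) U1"
    "weber_U a 0 = weber_coeff (a + 1/2) 0 / Gamma (a + 1/2)"
    "U1 0 = weber_coeff (a + 1/2) 1 / Gamma (a + 1/2)"
proof -
  define b where "b = a + 1/2"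
  have b: "Re b > 0" using a by (simp add: b_def)
  have a_eq: "a = b - 1/2" by (simp add: b_def)
  obtain g1 where g1: "\<And>z. (weber_series b has_field_derivative g1 z) (at z)"
    "\<And>z. (g1 has_field_derivative (z * g1 z + b * weber_series b z)) (at z)"
    "weber_series b 0 = weber_coeff b 0" "g1 0 = weber_coeff b 1"
    using weber_series_ode[OF b] by blast
  have Gnz: "Gamma b \<noteq> 0" using b by (auto simp: Gamma_eq_zero_iff elim!: nonpos_Ints_cases)
  define U1 where "U1 = (\<lambda>z. exp (- z\<^sup>2 / 4) * (g1 z - z / 2 * weber_series b z) / Gamma b)"
  have "(weber_U a has_field_derivative U1 z) (at z)" for z
    unfolding weber_U_def[abs_def] b_def[symmetric] U1_def divide_inverse[of _ "Gamma b"]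
    using Gnz by (auto intro!: derivative_eq_intros g1 simp: field_simps)
  moreover have "(U1 has_field_derivative (z\<^sup>2 / 4 + a) * weber_U a z) (at z)" for z
    unfolding weber_U_def b_def[symmetric] U1_def divide_inverse[of _ "Gamma b"]
    using Gnz by (auto intro!: derivative_eq_intros g1 simp: a_eq field_simps power2_eq_square)
  ultimately show ?thesis
    by (intro that[of U1]) (auto simp: ode_sol_def weber_U_def U1_def g1 b_def[symmetric])
qed

section \<open>Characterisation of U by its asymptotics\<close>

definition weber_asymp :: "complex \<Rightarrow> (complex \<Rightarrow> complex) \<Rightarrow> bool" where
  "weber_asymp a f \<longleftrightarrow> (\<forall>\<delta>>0. ((\<lambda>z. f z / (z powr (- a - 1/2) * exp (- z\<^sup>2 / 4))) \<longlongrightarrow> 1)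
              (inf at_infinity (principal {z. \<bar>Arg z\<bar> \<le> 3 * pi / 4 - \<delta>})))"

lemma weber_asymp_weber_U:
  assumes a: "Re a > -1/2"
  shows "weber_asymp a (weber_U a)"
  unfolding weber_asymp_def
proof (intro allI impI)
  fix \<delta> :: real assume \<delta>: "\<delta> > 0"
  have "Re (a + 1/2) > 0" using a by simp
  from weber_series_asymp[OF this \<delta>]
  show "((\<lambda>z. weber_U a z / (z powr (- a - 1/2) * exp (- z\<^sup>2 / 4))) \<longlongrightarrow> 1)
              (inf at_infinity (principal {z. \<bar>Arg z\<bar> \<le> 3 * pi / 4 - \<delta>}))"
    by (simp add: weber_U_def divide_divide_eq_left mult_ac)
qed

text \<open>The choice \<delta> = \<pi>/4 makes the sector the right half-plane, and for Re a > -1/2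
  the power of z is bounded there away from 0. Only the Gaussian is kept, uniformly up to and beyond
  the rays where Re (z^2) = 0.\<close>

lemma weber_asymp_bound:
  assumes f: "weber_asymp a f" and a: "Re a > -1/2"
  obtains R C where "R > 0" "C \<ge> 0"
    "\<And>z. Re z \<ge> 0 \<Longrightarrow> norm z \<ge> R \<Longrightarrow> norm (f z) \<le> C * exp (- Re (z\<^sup>2) / 4)"
proof -
  let ?h = "\<lambda>z. z powr (- a - 1/2) * exp (- z\<^sup>2 / 4)"
  have "((\<lambda>z. f z / ?h z) \<longlongrightarrow> 1) (inf at_infinity (principal {z. \<bar>Arg z\<bar> \<le> 3 * pi / 4 - pi / 4}))"
    using f[unfolded weber_asymp_def, rule_format, of "pi / 4"] by simp
  from tendstoD[OF this, of 1]
  have "eventually (\<lambda>z. \<bar>Arg z\<bar> \<le> pi / 2 \<longrightarrow> dist (f z / ?h z) 1 < 1) at_infinity"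
    by (simp add: eventually_inf_principal)
  then obtain R where R: "\<And>z. norm z \<ge> R \<Longrightarrow> \<bar>Arg z\<bar> \<le> pi / 2 \<Longrightarrow> dist (f z / ?h z) 1 < 1"
    unfolding eventually_at_infinity by blast
  show ?thesis
  \<comment> \<open>The quotient is within 1 of its limit 1, hence of norm at most 2; exp(|Im a|
    \<pi>) bounds the contribution of Arg z to the complex power.\<close>
  proof (rule that[of "max R 1" "2 * exp (\<bar>Im a\<bar> * pi)"])
    fix z :: complex assume z: "Re z \<ge> 0" "norm z \<ge> max R 1"
    then have znz: "z \<noteq> 0" by auto
    then have hnz: "?h z \<noteq> 0" by simp
    have "norm (f z / ?h z) \<le> 2"
    proof -
      have "norm (f z / ?h z - 1) < 1" using R[of z] Arg_Re_nonneg[THEN iffD2, OF z(1)] z(2) by (simp add: dist_norm)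
      then show ?thesis using norm_triangle_ineq2[of "f z / ?h z" 1] by simp
    qed
    then have "norm (f z) \<le> 2 * norm (?h z)"
      using hnz by (simp add: norm_divide divide_le_eq)
    also have "norm (?h z) = norm z powr (- Re a - 1/2) * exp (Im a * Arg z) * exp (- Re (z\<^sup>2) / 4)"
      by (simp add: norm_mult norm_powr_complex)
    also have "norm z powr (- Re a - 1/2) \<le> norm z powr 0"
      using z a by (intro powr_mono) auto
    also have "norm z powr 0 = 1" using znz by simp
    also have "Im a * Arg z \<le> \<bar>Im a\<bar> * pi"
    proof -
      have "\<bar>Im a * Arg z\<bar> \<le> \<bar>Im a\<bar> * pi"
        unfolding abs_mult using Arg_Re_nonneg[THEN iffD2, OF z(1)] by (intro mult_left_mono) auto
      then show ?thesis by linarith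
    qed
    finally show "norm (f z) \<le> 2 * exp (\<bar>Im a\<bar> * pi) * exp (- Re (z\<^sup>2) / 4)"
      by simp
  qed auto
qed

lemma filterlim_of_real_right_sector:
  assumes "\<beta> \<ge> 0"
  shows "filterlim complex_of_real (inf at_infinity (principal {z. \<bar>Arg z\<bar> \<le> \<beta>})) at_top"
  unfolding filterlim_inf filterlim_principal
proof
  show "filterlim complex_of_real at_infinity at_top"
    by (intro filterlim_norm_at_top_imp_at_infinity) (simp add: filterlim_abs_real)
  show "\<forall>\<^sub>F x in at_top. complex_of_real x \<in> {z. \<bar>Arg z\<bar> \<le> \<beta>}"
    using eventually_gt_at_top[of 0] by eventually_elim (use assms in auto)
qed

lemma weber_asymp_at_top:
  assumes "weber_asymp a f"
  shows "((\<lambda>x. f (of_real x) / (of_real x powr (- a - 1/2) * exp (- (of_real x)\<^sup>2 / 4))) \<longlongrightarrow> 1) at_top"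
proof -
  have "((\<lambda>z. f z / (z powr (- a - 1/2) * exp (- z\<^sup>2 / 4))) \<longlongrightarrow> 1)
     (inf at_infinity (principal {z. \<bar>Arg z\<bar> \<le> 3 * pi / 4 - pi / 4}))"
    using assms[unfolded weber_asymp_def, rule_format, of "pi / 4"] by simp
  from filterlim_compose[OF this filterlim_of_real_right_sector] show ?thesis by simp
qed

text \<open>The asymptotics say nothing directly about the derivative. Cauchy's inequality on the
  unit disc about x supplies it, which is why the bound is first proved for all z within distance 1
  of x.\<close>

lemma weber_asymp_decay:
  assumes f: "weber_asymp a f" and a: "Re a > -1/2" and sol: "ode_sol q f f1"
  shows "((\<lambda>x. f (of_real x)) \<longlongrightarrow> 0) at_top" "((\<lambda>x. f1 (of_real x)) \<longlongrightarrow> 0) at_top"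
proof -
  obtain R C where RC: "R > 0" "C \<ge> 0"
    "\<And>z. Re z \<ge> 0 \<Longrightarrow> norm z \<ge> R \<Longrightarrow> norm (f z) \<le> C * exp (- Re (z\<^sup>2) / 4)"
    using weber_asymp_bound[OF f a] by blast
  \<comment> \<open>On that disc Re z \<ge> x - 1 and |Im z| \<le> 1, so Re (z^2) \<ge> (x - 1)^2 -
    1.\<close>
  define B where "B = (\<lambda>x::real. C * exp (- ((x - 1)\<^sup>2 - 1) / 4))"
  have bound: "norm (f z) \<le> B x" if x: "x \<ge> R + 1" and z: "norm (of_real x - z) \<le> 1" for x z
  proof -
    have 1: "\<bar>x - Re z\<bar> \<le> 1" "\<bar>Im z\<bar> \<le> 1"
      using abs_Re_le_cmod[of "of_real x - z"] abs_Im_le_cmod[of "of_real x - z"] z by auto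
    then have Rez: "Re z \<ge> x - 1" by linarith
    then have "norm z \<ge> R" using complex_Re_le_cmod[of z] x by linarith
    moreover have "Re z \<ge> 0" using Rez x RC(1) by linarith
    ultimately have "norm (f z) \<le> C * exp (- Re (z\<^sup>2) / 4)" using RC(3) by blast
    also have "\<dots> \<le> B x"
    proof -
      have "(x - 1)\<^sup>2 \<le> (Re z)\<^sup>2" using Rez x RC(1) by (intro power_mono) auto
      moreover have "(Im z)\<^sup>2 \<le> 1" using 1(2) by (simp add: abs_square_le_1)
      ultimately show ?thesis unfolding B_def using RC(2)
        by (intro mult_left_mono) (auto simp: Re_power2)
    qed
    finally show ?thesis .
  qed
  have "((\<lambda>x::real. exp (- ((x - 1)\<^sup>2 - 1) / 4)) \<longlongrightarrow> 0) at_top"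
    by real_asymp
  then have B: "(B \<longlongrightarrow> 0) at_top"
    unfolding B_def by (rule tendsto_mult_right_zero)
  have "eventually (\<lambda>x. norm (f (of_real x)) \<le> B x) at_top"
    using eventually_ge_at_top[of "R + 1"] by eventually_elim (auto intro: bound)
  then show "((\<lambda>x. f (of_real x)) \<longlongrightarrow> 0) at_top"
    using B by (rule Lim_null_comparison)
  have "eventually (\<lambda>x. norm (f1 (of_real x)) \<le> B x) at_top"
    using eventually_ge_at_top[of "R + 1"]
  proof eventually_elim
    case (elim x)
    have "norm ((deriv ^^ 1) f (of_real x)) \<le> fact 1 * B x / 1 ^ 1"
      using ode_sol_holomorphic(1)[OF sol] elim
      by (intro Cauchy_inequality) (auto intro!: bound holomorphic_on_imp_continuous_on)
    then show ?case by (simp add: ode_sol_deriv[OF sol])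
  qed
  then show "((\<lambda>x. f1 (of_real x)) \<longlongrightarrow> 0) at_top"
    using B by (rule Lim_null_comparison)
qed

text \<open>For uniqueness: the Wronskian of two solutions with these asymptotics is constant and
  tends to 0 on the positive axis, hence is 0. The solutions are therefore proportional, and the
  normalisation of the limit to 1 fixes the factor.\<close>

lemma PCF_U_eq_weber_U:
  assumes a: "Re a > -1/2"
  shows "PCF_U a = weber_U a"
  unfolding PCF_U_def weber_asymp_def[symmetric]
proof (rule the_equality)
  let ?q = "\<lambda>z. z\<^sup>2 / 4 + a"
  obtain U1 where U: "ode_sol ?q (weber_U a) U1" using weber_U_ode[OF a] by blast
  show "weber_U a holomorphic_on UNIV \<and> (\<forall>z. deriv (deriv (weber_U a)) z = ?q z * weber_U a z) \<and>
    weber_asymp a (weber_U a)"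
    using ode_sol_holomorphic[OF U] ode_sol_deriv[OF U] weber_asymp_weber_U[OF a] by auto
  fix f assume f: "f holomorphic_on UNIV \<and> (\<forall>z. deriv (deriv f) z = ?q z * f z) \<and> weber_asymp a f"
  define f1 where "f1 = deriv f"
  have fs: "ode_sol ?q f f1"
    unfolding ode_sol_def f1_def using f
    by (metis UNIV_I holomorphic_derivI holomorphic_deriv open_UNIV)
  have "((\<lambda>x. f (of_real x) * U1 (of_real x) - f1 (of_real x) * weber_U a (of_real x)) \<longlongrightarrow> 0 * 0 - 0 * 0) at_top"
    using f weber_asymp_weber_U[OF a]
    by (intro tendsto_intros weber_asymp_decay[OF _ a U] weber_asymp_decay[OF _ a fs]) auto
  moreover have "(\<lambda>x::real. f (of_real x) * U1 (of_real x) - f1 (of_real x) * weber_U a (of_real x)) =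
     (\<lambda>x. f 0 * U1 0 - f1 0 * weber_U a 0)"
    using ode_sol_Wronskian_const[OF fs U] by blast
  ultimately have "f 0 * U1 0 - f1 0 * weber_U a 0 = 0"
    by (simp add: tendsto_const_iff)
  then have W: "f z * U1 z - f1 z * weber_U a z = 0" for z
    using ode_sol_Wronskian_const[OF fs U, of z 0] by simp
  let ?h = "\<lambda>x. complex_of_real x powr (- a - 1/2) * exp (- (of_real x)\<^sup>2 / 4)"
  have Uh: "((\<lambda>x. weber_U a (of_real x) / ?h x) \<longlongrightarrow> 1) at_top"
    by (intro weber_asymp_at_top weber_asymp_weber_U a)
  then have "eventually (\<lambda>x. weber_U a (of_real x) / ?h x \<noteq> 0) at_top"
    by (rule tendsto_imp_eventually_ne) simp
  then obtain x :: real where x: "weber_U a (of_real x) \<noteq> 0"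
    by (auto simp: eventually_at_top_linorder)
  define c where "c = f (of_real x) / weber_U a (of_real x)"
  \<comment> \<open>The combination f - c U vanishes at x by the choice of c; its derivative
    vanishes there too, since the Wronskian is 0 and U(x) is not.\<close>
  have "ode_sol ?q (\<lambda>z. 1 * f z + (- c) * weber_U a z) (\<lambda>z. 1 * f1 z + (- c) * U1 z)"
    by (intro ode_sol_lincomb fs U)
  then have "1 * f z + (- c) * weber_U a z = 0" for z
    by (rule ode_sol_eq_0[of _ _ _ "of_real x"])
      (use x W[of "of_real x"] in \<open>auto intro!: holomorphic_intros simp: c_def field_simps\<close>)
  then have fc: "f z = c * weber_U a z" for z by (simp add: algebra_simps)
  have "((\<lambda>x. f (of_real x) / ?h x) \<longlongrightarrow> 1) at_top"
    using f by (intro weber_asymp_at_top) auto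
  moreover have "((\<lambda>x. c * (weber_U a (of_real x) / ?h x)) \<longlongrightarrow> c * 1) at_top"
    by (intro tendsto_intros Uh)
  ultimately have "c = 1"
    using tendsto_unique[of "at_top :: real filter"] by (fastforce simp: fc)
  then show "f = weber_U a" using fc by auto
qed

lemma ode_sol_scale:
  assumes "ode_sol q f f1"
  shows "ode_sol (\<lambda>z. c\<^sup>2 * q (c * z)) (\<lambda>z. f (c * z)) (\<lambda>z. c * f1 (c * z))"
proof -
  have 1: "((\<lambda>z. f (c * z)) has_field_derivative f1 (c * z) * c) (at z)" for z
    using assms unfolding ode_sol_def
    by (intro DERIV_chain2[where g = "\<lambda>z. c * z"]) (auto intro!: derivative_eq_intros)
  have 2: "((\<lambda>z. f1 (c * z)) has_field_derivative (q (c * z) * f (c * z)) * c) (at z)" for z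
    using assms unfolding ode_sol_def
    by (intro DERIV_chain2[where g = "\<lambda>z. c * z"]) (auto intro!: derivative_eq_intros)
  from DERIV_cmult[OF 2, of c] 1 show ?thesis
    by (simp add: ode_sol_def power2_eq_square mult_ac)
qed

section \<open>Connection formulas\<close>

text \<open>Duplication at (1 - b)/2 together with reflection at b/2 and (1 + b)/2. These quotients
  occur in the data at 0 of U(-a,.), and the right-hand sides rewrite them through those of
  U(a,.).\<close>

lemma Gamma_half_ratio:
  assumes b: "0 < Re b" "Re b < 1"
  shows "Gamma ((1 - b) / 2) / Gamma (1 - b) =
           exp (b * of_real (ln 2)) * Gamma (b / 2) * sin (of_real pi * (b / 2)) / of_real (sqrt pi)"
    and "Gamma (1 - b / 2) / Gamma (1 - b) =
           exp (b * of_real (ln 2)) * Gamma ((1 + b) / 2) * cos (of_real pi * (b / 2)) / of_real (sqrt pi)"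
proof -
  have nz: "Gamma z \<noteq> 0" if "Re z > 0" for z :: complex
    using that by (auto simp: Gamma_eq_zero_iff elim!: nonpos_Ints_cases)
  have ni: "z \<notin> \<int>\<^sub>\<le>\<^sub>0" if "Re z > 0" for z :: complex
    using that by (auto elim!: nonpos_Ints_cases)
  have half: "(1 - b) / 2 + 1/2 = 1 - b / 2" by (simp add: field_simps)
  have twice: "2 * ((1 - b) / 2) = 1 - b" by simp
  have dup: "Gamma ((1 - b) / 2) * Gamma (1 - b / 2) = exp (b * of_real (ln 2)) * of_real (sqrt pi) * Gamma (1 - b)"
    using Gamma_legendre_duplication[of "(1 - b) / 2"] b unfolding half twice by (simp add: ni del: times_divide_eq_right)
  have pi: "complex_of_real pi = of_real (sqrt pi) * of_real (sqrt pi)"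
    by (simp flip: of_real_mult)
  have sqnz: "complex_of_real (sqrt pi) \<noteq> 0" by simp
  have r1: "Gamma (b / 2) * Gamma (1 - b / 2) = of_real pi / sin (of_real pi * (b / 2))"
    by (rule Gamma_reflection_complex)
  have "Gamma (b / 2) * Gamma (1 - b / 2) \<noteq> 0" using b by (simp add: nz)
  then have s1: "sin (of_real pi * (b / 2)) \<noteq> 0" using r1 by auto
  have "1 - (1 + b) / 2 = (1 - b) / 2" by (simp add: field_simps)
  then have r2: "Gamma ((1 + b) / 2) * Gamma ((1 - b) / 2) = of_real pi / sin (of_real pi * ((1 + b) / 2))"
    using Gamma_reflection_complex[of "(1 + b) / 2"] by (simp only:)
  have "sin (of_real pi * ((1 + b) / 2)) = sin (of_real pi * (b / 2) + of_real pi / 2)"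
    by (simp add: field_simps)
  also have "\<dots> = cos (of_real pi * (b / 2))"
    by (simp add: sin_add)
  finally have sc: "sin (of_real pi * ((1 + b) / 2)) = cos (of_real pi * (b / 2))" .
  have "Gamma ((1 + b) / 2) * Gamma ((1 - b) / 2) \<noteq> 0" using b by (simp add: nz)
  then have s2: "cos (of_real pi * (b / 2)) \<noteq> 0" using r2 sc by auto
  have g: "Gamma (1 - b / 2) \<noteq> 0" "Gamma (1 - b) \<noteq> 0" "Gamma ((1 - b) / 2) \<noteq> 0"
    using b by (auto intro!: nz)
  have e1: "Gamma (b / 2) * sin (of_real pi * (b / 2)) = of_real (sqrt pi) * of_real (sqrt pi) / Gamma (1 - b / 2)"
    unfolding pi[symmetric] using r1 s1 g by (simp add: field_simps)
  have e2: "Gamma ((1 + b) / 2) * cos (of_real pi * (b / 2)) = of_real (sqrt pi) * of_real (sqrt pi) / Gamma ((1 - b) / 2)"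
    unfolding pi[symmetric] using r2 s2 g unfolding sc by (simp add: field_simps)
  show "Gamma ((1 - b) / 2) / Gamma (1 - b) =
           exp (b * of_real (ln 2)) * Gamma (b / 2) * sin (of_real pi * (b / 2)) / of_real (sqrt pi)"
    unfolding mult.assoc[of _ "Gamma _" "sin _"] e1 using dup g sqnz by (simp add: field_simps)
  show "Gamma (1 - b / 2) / Gamma (1 - b) =
           exp (b * of_real (ln 2)) * Gamma ((1 + b) / 2) * cos (of_real pi * (b / 2)) / of_real (sqrt pi)"
    unfolding mult.assoc[of _ "Gamma _" "cos _"] e2 using dup g sqnz by (simp add: field_simps)
qed

lemma exp_i_pi_half: "exp (\<i> * of_real pi / 2) = \<i>"
  by (simp add: complex_eq_iff Re_exp Im_exp)

text \<open>Replacing z by i z turns the equation with parameter -a into that with parameter a, so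
  both sides solve one equation and only value and derivative at 0 have to match. The strip keeps
  both b and 1 - b in the half-plane of the integral.\<close>

lemma weber_U_connection:
  assumes a: "\<bar>Re a\<bar> < 1/2"
  shows "of_real (sqrt (2 * pi)) * weber_U (- a) (\<i> * z) =
    Gamma (1/2 + a) * (exp (- (\<i> * of_real pi * (a / 2 - 1/4))) * weber_U a z +
                       exp (\<i> * of_real pi * (a / 2 - 1/4)) * weber_U a (- z))"
proof -
  define b where "b = a + 1/2"
  define Y where "Y = of_real pi * (b / 2)"
  define L where "L = complex_of_real (ln 2)"
  have b: "0 < Re b" "Re b < 1" using a by (auto simp: b_def)
  have Gnz: "Gamma b \<noteq> 0" using b by (auto simp: Gamma_eq_zero_iff elim!: nonpos_Ints_cases)
  have ab: "- a + 1/2 = 1 - b" "1/2 + a = b" by (auto simp: b_def)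
  have a1: "Re a > -1/2" "Re (- a) > -1/2" using a by auto
  obtain U1 where U1: "ode_sol (\<lambda>z. z\<^sup>2 / 4 + a) (weber_U a) U1"
    "weber_U a 0 = weber_coeff b 0 / Gamma b" "U1 0 = weber_coeff b 1 / Gamma b"
    using weber_U_ode[OF a1(1)] unfolding b_def by blast
  obtain V1 where V1: "ode_sol (\<lambda>z. z\<^sup>2 / 4 + - a) (weber_U (- a)) V1"
    "weber_U (- a) 0 = weber_coeff (1 - b) 0 / Gamma (1 - b)" "V1 0 = weber_coeff (1 - b) 1 / Gamma (1 - b)"
    using weber_U_ode[OF a1(2)] unfolding ab by blast
  have s1: "ode_sol (\<lambda>z. z\<^sup>2 / 4 + a) (\<lambda>z. weber_U a (-1 * z)) (\<lambda>z. -1 * U1 (-1 * z))"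
    using ode_sol_scale[OF U1(1), of "-1"] by simp
  have s2: "ode_sol (\<lambda>z. z\<^sup>2 / 4 + a) (\<lambda>z. weber_U (- a) (\<i> * z)) (\<lambda>z. \<i> * V1 (\<i> * z))"
    using ode_sol_scale[OF V1(1), of "\<i>"] by (simp add: power_mult_distrib add.commute)
  define em ep where "em = exp (- (\<i> * of_real pi * (a / 2 - 1/4)))" and "ep = exp (\<i> * of_real pi * (a / 2 - 1/4))"
  have "em = exp (- \<i> * Y + \<i> * of_real pi / 2)"
    unfolding em_def Y_def b_def by (rule arg_cong[of _ _ exp]) (simp add: field_simps)
  then have em: "em = \<i> * exp (- \<i> * Y)"
    unfolding exp_add exp_i_pi_half by simp
  have "ep = exp (\<i> * Y - \<i> * of_real pi / 2)"
    unfolding ep_def Y_def b_def by (rule arg_cong[of _ _ exp]) (simp add: field_simps)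
  then have ep: "ep = - \<i> * exp (\<i> * Y)"
    unfolding exp_diff exp_i_pi_half by (simp add: field_simps)
  \<comment> \<open>The sum goes with the value at 0, the difference with the derivative, since
    U(a,-z) contributes its derivative with a minus sign. Sine and cosine are those of
    \<open>Gamma_half_ratio\<close>.\<close>
  have sum_e: "em + ep = 2 * sin Y" and diff_e: "em - ep = 2 * \<i> * cos Y"
    unfolding em ep sin_exp_eq cos_exp_eq by (auto simp: field_simps)
  have sqrt2: "complex_of_real (sqrt (2 * pi)) = exp (L / 2) * of_real (sqrt pi)"
  proof -
    have "sqrt 2 = exp (ln 2 / 2)"
      by (rule real_sqrt_unique) (auto simp: power2_eq_square exp_add[symmetric])
    then have "complex_of_real (sqrt 2) = exp (L / 2)"
      by (simp add: L_def exp_of_real[symmetric])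
    then show ?thesis by (simp add: real_sqrt_mult)
  qed
  have two: "2 powr z = exp (z * L)" for z
    by (simp add: powr_def L_def Ln_of_real[of 2, simplified])
  have eL: "exp L = 2"
    unfolding L_def exp_of_real by simp
  let ?D = "\<lambda>z. of_real (sqrt (2 * pi)) * weber_U (- a) (\<i> * z) + (- 1) * (Gamma b * em * weber_U a z + Gamma b * ep * weber_U a (-1 * z))"
  have "ode_sol (\<lambda>z. z\<^sup>2 / 4 + a) ?D
      (\<lambda>z. of_real (sqrt (2 * pi)) * (\<i> * V1 (\<i> * z)) + (- 1) * (Gamma b * em * U1 z + Gamma b * ep * (-1 * U1 (-1 * z))))"
    by (intro ode_sol_lincomb s1 s2 U1(1))
  then have "?D z = 0"
  proof (rule ode_sol_eq_0[of _ _ _ 0])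
    show "(\<lambda>z. z\<^sup>2 / 4 + a) holomorphic_on UNIV" by (intro holomorphic_intros) auto
    have "of_real (sqrt (2 * pi)) * weber_U (- a) 0 = 2 * sin Y * weber_coeff b 0"
    proof -
      have "of_real (sqrt (2 * pi)) * weber_U (- a) 0 =
        exp (L / 2) * of_real (sqrt pi) * (exp (((1 - b) / 2 - 1) * L) * (Gamma ((1 - b) / 2) / Gamma (1 - b)))"
        unfolding V1 sqrt2 weber_coeff_def two by simp
      also have "\<dots> = exp (L / 2) * exp (((1 - b) / 2 - 1) * L) * exp (b * L) * (Gamma (b / 2) * sin Y)"
        unfolding Gamma_half_ratio(1)[OF b] L_def Y_def by simp
      also have "exp (L / 2) * exp (((1 - b) / 2 - 1) * L) * exp (b * L) = exp (L + (b / 2 - 1) * L)"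
        unfolding exp_add[symmetric] by (rule arg_cong[of _ _ exp]) (simp add: field_simps)
      also have "\<dots> = 2 * exp ((b / 2 - 1) * L)" by (simp add: exp_add eL)
      finally show ?thesis unfolding weber_coeff_def two by simp
    qed
    then show "of_real (sqrt (2 * pi)) * weber_U (- a) (\<i> * 0) + (- 1) * (Gamma b * em * weber_U a 0 + Gamma b * ep * weber_U a (-1 * 0)) = 0"
      using Gnz sum_e by (simp add: U1 flip: distrib_right)
    have "of_real (sqrt (2 * pi)) * V1 0 = 2 * cos Y * weber_coeff b 1"
    proof -
      have "of_real (sqrt (2 * pi)) * V1 0 =
        - (exp (L / 2) * of_real (sqrt pi) * (exp (((1 - b + 1) / 2 - 1) * L) * (Gamma ((1 - b + 1) / 2) / Gamma (1 - b))))"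
        unfolding V1 sqrt2 weber_coeff_def two by simp
      also have "(1 - b + 1) / 2 = 1 - b / 2" by (simp add: field_simps)
      also have "exp (L / 2) * of_real (sqrt pi) * (exp ((1 - b / 2 - 1) * L) * (Gamma (1 - b / 2) / Gamma (1 - b))) =
         exp (L / 2) * exp ((1 - b / 2 - 1) * L) * exp (b * L) * (Gamma ((1 + b) / 2) * cos Y)"
        unfolding Gamma_half_ratio(2)[OF b] L_def Y_def by simp
      also have "exp (L / 2) * exp ((1 - b / 2 - 1) * L) * exp (b * L) = exp (L + ((b + 1) / 2 - 1) * L)"
        unfolding exp_add[symmetric] by (rule arg_cong[of _ _ exp]) (simp add: field_simps)
      also have "\<dots> = 2 * exp (((b + 1) / 2 - 1) * L)" by (simp add: exp_add eL)
      finally show ?thesis unfolding weber_coeff_def two by (simp add: add.commute)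
    qed
    moreover have "Gamma b * em * U1 0 + Gamma b * ep * (-1 * U1 0) = (em - ep) * (Gamma b * U1 0)"
      by (simp add: algebra_simps)
    ultimately show "of_real (sqrt (2 * pi)) * (\<i> * V1 (\<i> * 0)) + (- 1) * (Gamma b * em * U1 0 + Gamma b * ep * (-1 * U1 (-1 * 0))) = 0"
      using Gnz diff_e by (simp add: U1)
  qed
  then show ?thesis
    unfolding ab em_def[symmetric] ep_def[symmetric] by (simp add: algebra_simps)
qed

section \<open>Phase and modulus of Gamma at 1/2 + i a\<close>

text \<open>The imaginary part of \<open>ln_Gamma\<close> on the right half-plane is a continuous
  phase vanishing at a = 0. Two such phases differ by 2 \<pi> times a continuous integer-valued
  function, hence by a constant, which is 0.\<close>

lemma Gamma_phi2:
  "Gamma (1/2 + \<i> * of_real a) = of_real (cmod (Gamma (1/2 + \<i> * of_real a))) * exp (\<i> * of_real (phi2 a))"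
proof -
  let ?P = "\<lambda>\<phi>. continuous_on UNIV \<phi> \<and> \<phi> 0 = 0 \<and>
      (\<forall>a. Gamma (1/2 + \<i> * complex_of_real a) =
            complex_of_real (cmod (Gamma (1/2 + \<i> * complex_of_real a)))
              * exp (\<i> * complex_of_real (\<phi> a)))"
  define \<phi>0 where "\<phi>0 = (\<lambda>a. Im (ln_Gamma (1/2 + \<i> * complex_of_real a)))"
  have "?P \<phi>0"
  proof (intro conjI allI)
    show "continuous_on UNIV \<phi>0"
      unfolding \<phi>0_def
      by (intro continuous_intros continuous_on_compose2[OF continuous_on_ln_Gamma_complex[of "{z. Re z > 0}"]])
        (auto simp: complex_nonpos_Reals_iff)
    have "complex_of_real (1/2) = 1/2" by simp
    then show "\<phi>0 0 = 0"
      using ln_Gamma_complex_of_real[of "1/2"] by (simp add: \<phi>0_def)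
    fix a :: real
    have "1/2 + \<i> * complex_of_real a \<notin> \<int>\<^sub>\<le>\<^sub>0"
      by (auto elim!: nonpos_Ints_cases simp: complex_eq_iff)
    then have G: "Gamma (1/2 + \<i> * complex_of_real a) = exp (ln_Gamma (1/2 + \<i> * complex_of_real a))"
      by (simp add: Gamma_complex_altdef)
    show "Gamma (1/2 + \<i> * complex_of_real a) = complex_of_real (cmod (Gamma (1/2 + \<i> * complex_of_real a)))
              * exp (\<i> * complex_of_real (\<phi>0 a))"
      unfolding G by (simp add: exp_eq_polar[of "ln_Gamma _"] \<phi>0_def cis_conv_exp norm_mult)
  qed
  moreover have "\<psi> = \<phi>0" if \<psi>: "?P \<psi>" for \<psi>
  proof -
    define d where "d = (\<lambda>a. (\<psi> a - \<phi>0 a) / (2 * pi))"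
    have int: "d a \<in> \<int>" for a
    proof -
      have "Gamma (1/2 + \<i> * complex_of_real a) \<noteq> 0"
        by (auto simp: Gamma_eq_zero_iff elim!: nonpos_Ints_cases dest: arg_cong[of _ _ Re])
      then have "exp (\<i> * complex_of_real (\<psi> a)) = exp (\<i> * complex_of_real (\<phi>0 a))"
        using \<psi> \<open>?P \<phi>0\<close> by (metis mult_cancel_left mult_zero_left)
      then obtain n :: int where "\<i> * complex_of_real (\<psi> a) = \<i> * complex_of_real (\<phi>0 a) + of_int (2 * n) * pi * \<i>"
        unfolding exp_eq by blast
      then have "\<psi> a = \<phi>0 a + 2 * n * pi"
        by (auto simp: complex_eq_iff)
      then show ?thesis by (simp add: d_def)
    qed
    have "continuous_on UNIV d"
      unfolding d_def using \<psi> \<open>?P \<phi>0\<close> by (intro continuous_intros) auto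
    moreover have "\<exists>e>0. \<forall>y. y \<in> UNIV \<and> d y \<noteq> d x \<longrightarrow> e \<le> norm (d y - d x)" for x
    proof (intro exI[of _ 1] conjI allI impI)
      fix y assume "y \<in> UNIV \<and> d y \<noteq> d x"
      then show "1 \<le> norm (d y - d x)"
        using int[of x] int[of y] by (auto elim!: Ints_cases simp flip: of_int_diff)
    qed auto
    ultimately have "d constant_on UNIV"
      by (intro continuous_discrete_range_constant) auto
    then have "d a = d 0" for a by (auto simp: constant_on_def)
    then show ?thesis using \<psi> \<open>?P \<phi>0\<close> by (auto simp: d_def)
  qed
  ultimately have "?P phi2"
    unfolding phi2_def by (rule theI)
  then show ?thesis by blast
qed

text \<open>Reflection pairs 1/2 + i a with its conjugate and gives |\<Gamma>|^2 = \<pi> /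
  cosh(\<pi> a). In this form sqrt(2 \<pi>) in the connection formula becomes a multiple of
  |\<Gamma>|, which then cancels.\<close>

lemma norm_Gamma_half_plus:
  "sqrt (2 * pi) = cmod (Gamma (1/2 + \<i> * of_real a)) * exp (- (pi * a / 2)) * sqrt (1 + exp (2 * pi * a))"
proof -
  let ?G = "Gamma (1/2 + \<i> * complex_of_real a)"
  have "complex_of_real ((cmod ?G)\<^sup>2) = ?G * Gamma (1 - (1/2 + \<i> * of_real a))"
    unfolding complex_norm_square cnj_Gamma by simp
  also have "\<dots> = of_real pi / sin (of_real pi * (1/2 + \<i> * of_real a))"
    by (rule Gamma_reflection_complex)
  also have "of_real pi * (1/2 + \<i> * of_real a) = of_real (pi * a) * \<i> + of_real pi / 2"
    by (simp add: algebra_simps)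
  also have "sin \<dots> = cos (of_real (pi * a) * \<i>)"
    by (simp add: sin_add)
  also have "\<dots> = of_real (cosh (pi * a))"
    by (simp add: cos_exp_eq cosh_def exp_of_real[symmetric] scaleR_conv_of_real mult_ac)
  finally have "(cmod ?G)\<^sup>2 = pi / cosh (pi * a)"
    by (metis of_real_divide of_real_eq_iff)
  then have G2: "(cmod ?G)\<^sup>2 * cosh (pi * a) = pi" by (simp add: cosh_real_nonzero)
  have "(cmod ?G * exp (- (pi * a / 2)) * sqrt (1 + exp (2 * pi * a)))\<^sup>2 =
    (cmod ?G)\<^sup>2 * (exp (- (pi * a)) * (1 + exp (2 * pi * a)))"
    by (simp add: power_mult_distrib exp_double[symmetric] add_nonneg_nonneg)
  also have "exp (- (pi * a)) * (1 + exp (2 * pi * a)) = 2 * cosh (pi * a)"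
    by (simp add: cosh_def algebra_simps flip: exp_add)
  finally show ?thesis
    using G2 by (intro real_sqrt_unique) auto
qed

section \<open>Reflection formulas for W_0, W_3 and W\<close>

lemma Wj_0: "Wj 0 a z = weber_U (\<i> * of_real a) (z * exp (- pi * \<i> / 4))"
  unfolding Wj_def by (simp add: PCF_U_eq_weber_U)

lemma Wj_3: "Wj 3 a z = weber_U (- (\<i> * of_real a)) (z * exp (pi * \<i> / 4))"
proof -
  have "exp (complex_of_real pi * \<i> / 4) = exp (\<i> * pi / 2 + - (complex_of_real pi * \<i> / 4))"
    by (rule arg_cong[of _ _ exp]) (simp add: field_simps)
  also have "\<dots> = \<i> * exp (- complex_of_real pi * \<i> / 4)"
    unfolding exp_add exp_i_pi_half by simp
  finally have "(- \<i>) ^ 3 * z * exp (- pi * \<i> / 4) = z * exp (pi * \<i> / 4)"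
    by (simp add: power3_eq_cube)
  moreover have "(- 1) ^ 3 * \<i> * complex_of_real a = - (\<i> * of_real a)"
    by (simp add: power3_eq_cube)
  ultimately show ?thesis
    unfolding Wj_def by (simp only:) (simp add: PCF_U_eq_weber_U)
qed

text \<open>Multiplication by i moves the point z e^(-i \<pi>/4) to z e^(i \<pi>/4), so at this
  point the rotated function in \<open>weber_U_connection\<close> is W_3. After the modulus of Gamma
  cancels, its phase remains as \<open>phi2\<close>.\<close>

lemma Wj_0_minus:
  "Wj 0 a (- z) = - \<i> * of_real (exp (pi * a)) * Wj 0 a z +
     exp (\<i> * of_real (pi / 4 - phi2 a)) * of_real (sqrt (1 + exp (2 * pi * a))) * Wj 3 a z"
proof -
  define E S where "E = complex_of_real (exp (pi * a / 2))" and "S = complex_of_real (sqrt (1 + exp (2 * pi * a)))"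
  define c p where "c = exp (complex_of_real pi * \<i> / 4)" and "p = exp (\<i> * complex_of_real (phi2 a))"
  define g where "g = complex_of_real (cmod (Gamma (1/2 + \<i> * of_real a)))"
  have nz: "E \<noteq> 0" "c \<noteq> 0" "p \<noteq> 0" by (auto simp: E_def c_def p_def)
  have gnz: "g \<noteq> 0"
    by (auto simp: g_def Gamma_eq_zero_iff elim!: nonpos_Ints_cases dest: arg_cong[of _ _ Re])
  have c2: "c * c = \<i>"
    unfolding c_def exp_add[symmetric] using exp_i_pi_half by (simp add: mult_ac)
  have cinv: "exp (- pi * \<i> / 4) = inverse c" "inverse c = - \<i> * c"
    using c2 nz by (auto simp: c_def exp_minus field_simps)
  have sq: "complex_of_real (sqrt (2 * pi)) = g * inverse E * S"
    unfolding norm_Gamma_half_plus[of a] by (simp add: g_def E_def S_def exp_minus)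
  have G: "Gamma (1/2 + \<i> * of_real a) = g * p"
    unfolding g_def p_def by (rule Gamma_phi2)
  have "exp (- (\<i> * of_real pi * (\<i> * of_real a / 2 - 1/4))) = exp (complex_of_real (pi * a / 2) + complex_of_real pi * \<i> / 4)"
    by (rule arg_cong[of _ _ exp]) (simp add: algebra_simps)
  then have em: "exp (- (\<i> * of_real pi * (\<i> * of_real a / 2 - 1/4))) = E * c"
    unfolding exp_add exp_of_real E_def c_def .
  then have ep: "exp (\<i> * of_real pi * (\<i> * of_real a / 2 - 1/4)) = inverse E * inverse c"
    by (metis exp_minus inverse_inverse_eq inverse_mult_distrib)
  have "of_real (sqrt (2 * pi)) * weber_U (- (\<i> * of_real a)) (\<i> * (z * exp (- pi * \<i> / 4))) =
    Gamma (1/2 + \<i> * of_real a) * (E * c * weber_U (\<i> * of_real a) (z * exp (- pi * \<i> / 4)) +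
                       inverse E * inverse c * weber_U (\<i> * of_real a) (- (z * exp (- pi * \<i> / 4))))"
    unfolding em[symmetric] ep[symmetric] by (rule weber_U_connection) simp
  moreover have "\<i> * (z * exp (- pi * \<i> / 4)) = z * c"
    unfolding cinv by (simp add: algebra_simps)
  ultimately have "g * inverse E * S * Wj 3 a z = g * p * (E * c * Wj 0 a z + inverse E * inverse c * Wj 0 a (- z))"
    unfolding sq G Wj_0 Wj_3 c_def[symmetric] by (simp only: mult_minus_left)
  then have "inverse E * S * Wj 3 a z = p * (E * c * Wj 0 a z + inverse E * inverse c * Wj 0 a (- z))"
    using gnz by (simp add: mult.assoc)
  then have "E * (inverse E * S * Wj 3 a z) = E * (p * (E * c * Wj 0 a z + inverse E * inverse c * Wj 0 a (- z)))"
    by (rule arg_cong)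
  also have "\<dots> = p * (E * E * c * Wj 0 a z + (E * inverse E) * inverse c * Wj 0 a (- z))"
    by (simp only: algebra_simps)
  also have "E * (inverse E * S * Wj 3 a z) = (E * inverse E) * S * Wj 3 a z"
    by (simp only: mult_ac)
  finally have "S * Wj 3 a z = p * (E * E * c * Wj 0 a z + inverse c * Wj 0 a (- z))"
    using nz by simp
  then have "c * inverse p * S * Wj 3 a z = c * inverse p * (p * (E * E * c * Wj 0 a z + inverse c * Wj 0 a (- z)))"
    by simp
  also have "\<dots> = E * E * (c * c) * Wj 0 a z + Wj 0 a (- z)"
    using nz by (simp add: field_simps)
  finally have "Wj 0 a (- z) = - \<i> * (E * E) * Wj 0 a z + c * inverse p * S * Wj 3 a z"
    unfolding c2 by (simp add: algebra_simps)
  moreover have "E * E = of_real (exp (pi * a))"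
    by (simp add: E_def flip: exp_add of_real_mult)
  moreover have "c * inverse p = exp (\<i> * of_real (pi / 4 - phi2 a))"
  proof -
    have "exp (\<i> * of_real (pi / 4 - phi2 a)) = exp (complex_of_real pi * \<i> / 4 - \<i> * of_real (phi2 a))"
      by (rule arg_cong[of _ _ exp]) (simp add: algebra_simps)
    then show ?thesis unfolding exp_diff divide_inverse c_def p_def by (rule sym)
  qed
  ultimately show ?thesis by (simp add: S_def)
qed

text \<open>Reflecting \<open>Wj_0_minus\<close> once more returns W_0(z); eliminating W_0(-z)
  leaves W_3(-z), and S^2 = 1 + E^2 merges the two W_0 terms.\<close>

lemma Wj_3_minus:
  "Wj 3 a (- z) = \<i> * of_real (exp (pi * a)) * Wj 3 a z +
     exp (- (\<i> * of_real (pi / 4 - phi2 a))) * of_real (sqrt (1 + exp (2 * pi * a))) * Wj 0 a z"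
proof -
  define E S where "E = complex_of_real (exp (pi * a))" and "S = complex_of_real (sqrt (1 + exp (2 * pi * a)))"
  define q where "q = exp (\<i> * complex_of_real (pi / 4 - phi2 a))"
  have q: "q \<noteq> 0" by (simp add: q_def)
  have S: "S \<noteq> 0" "S * S = 1 + E * E"
    by (auto simp: S_def E_def add_pos_pos less_imp_neq[THEN not_sym] simp flip: of_real_mult exp_add)
  have 1: "Wj 0 a (- z) = - \<i> * E * Wj 0 a z + q * S * Wj 3 a z"
    unfolding Wj_0_minus E_def S_def q_def ..
  have 2: "Wj 0 a z = - \<i> * E * Wj 0 a (- z) + q * S * Wj 3 a (- z)"
    using Wj_0_minus[of a "- z"] unfolding E_def S_def q_def by simp
  have "q * S * Wj 3 a (- z) = Wj 0 a z + \<i> * E * Wj 0 a (- z)"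
    using 2 by (simp add: algebra_simps)
  also have "\<dots> = Wj 0 a z + \<i> * E * (- \<i> * E * Wj 0 a z + q * S * Wj 3 a z)"
    unfolding 1 ..
  also have "\<dots> = S * S * Wj 0 a z + \<i> * E * q * S * Wj 3 a z"
    by (simp add: S algebra_simps)
  also have "\<dots> = q * S * (\<i> * E * Wj 3 a z + inverse q * S * Wj 0 a z)"
    using q by (simp add: algebra_simps)
  finally show ?thesis
    using q S by (simp add: E_def S_def q_def exp_minus)
qed

lemma kW_mult: "kW a * (sqrt (1 + exp (2 * pi * a)) + exp (pi * a)) = 1"
proof -
  have "kW a * (sqrt (1 + exp (2 * pi * a)) + exp (pi * a)) = (sqrt (1 + exp (2 * pi * a)))\<^sup>2 - exp (pi * a) ^ 2"
    by (simp add: kW_def power2_eq_square algebra_simps)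
  also have "\<dots> = 1" by (simp add: add_nonneg_nonneg flip: exp_double)
  finally show ?thesis .
qed

text \<open>\<rho> is made for this: 2 \<rho> = \<open>phi2 a\<close> + \<pi>/4 turns the phase of
  the reflection formulas into i e^(-2 i \<rho>), so the coefficients of e^(i \<rho>) W_0 and e^(-i
  \<rho>) W_3 come out opposite. By \<open>kW_mult\<close> the real factor is 1/k.\<close>

lemma Wc_minus:
  "Wc a (- z) = - \<i> * of_real (sqrt (1 + exp (2 * pi * a)) + exp (pi * a)) *
     of_real (sqrt (kW a / 2) * exp (pi * a / 4)) *
     (exp (\<i> * of_real (rhoW a)) * Wj 0 a z - exp (- \<i> * of_real (rhoW a)) * Wj 3 a z)"
proof -
  define e where "e = exp (\<i> * complex_of_real (rhoW a))"
  have enz: "e \<noteq> 0" by (simp add: e_def)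
  have "exp (\<i> * of_real (pi / 4 - phi2 a)) = exp (- (\<i> * of_real (rhoW a)) + - (\<i> * of_real (rhoW a)) + \<i> * of_real pi / 2)"
    by (rule arg_cong[of _ _ exp]) (simp add: rhoW_def field_simps)
  also have "\<dots> = \<i> * inverse e * inverse e"
    unfolding exp_add exp_i_pi_half by (simp add: e_def exp_minus)
  finally have q: "exp (\<i> * of_real (pi / 4 - phi2 a)) = \<i> * inverse e * inverse e" .
  then have q': "exp (- (\<i> * of_real (pi / 4 - phi2 a))) = - \<i> * e * e"
    unfolding exp_minus by simp
  have e': "exp (- \<i> * of_real (rhoW a)) = inverse e"
    by (simp add: e_def exp_minus)
  show ?thesis
    unfolding Wc_def Wj_0_minus Wj_3_minus q q' e' e_def[symmetric] using enz
    by (simp add: field_simps)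
qed

section \<open>Rotation of the path of integration\<close>

text \<open>Both limits use \<open>norm (weber_U a w) \<le> C * exp (- Re (w\<^sup>2) / 4)\<close>. On a ray with
  \<open>Re (\<omega>\<^sup>2) = 0\<close> this bound does not decay; there the integral is compared with the real axis
  along the segment from \<open>T * \<omega>\<close> in direction \<open>cnj \<omega>\<close>, on which \<open>Re (w\<^sup>2)\<close> grows linearly at rate \<open>2 * T\<close>.\<close>

lemma weber_U_primitive_limit:
  assumes a: "Re a > -1/2" and G: "\<And>z. (G has_field_derivative weber_U a z) (at z)"
  obtains L where
    "\<And>w. ((\<lambda>T. G (w + of_real T)) \<longlongrightarrow> L) at_top"
    "\<And>\<omega>. norm \<omega> = 1 \<Longrightarrow> Re \<omega> > 0 \<Longrightarrow> Re (\<omega>\<^sup>2) = 0 \<Longrightarrow> ((\<lambda>T. G (of_real T * \<omega>)) \<longlongrightarrow> L) at_top"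
proof -
  obtain R C where RC: "R > 0" "C \<ge> 0"
    "\<And>z. Re z \<ge> 0 \<Longrightarrow> norm z \<ge> R \<Longrightarrow> norm (weber_U a z) \<le> C * exp (- Re (z\<^sup>2) / 4)"
    using weber_asymp_bound[OF weber_asymp_weber_U[OF a] a] by blast
  \<comment> \<open>Mean value estimate along a line: the increment of G is controlled by a real H
    whose derivative dominates the speed. It serves both the real axis and the skew segment.\<close>
  have curve: "norm (G (\<gamma> t) - G (\<gamma> s)) \<le> H t - H s"
    if st: "s < t" and \<gamma>: "\<And>x. (\<gamma> has_vector_derivative \<gamma>' ) (at x)"
      and H: "\<And>x. (H has_real_derivative h x) (at x)"
      and le: "\<And>x. s < x \<Longrightarrow> x < t \<Longrightarrow> norm (weber_U a (\<gamma> x) * \<gamma>') \<le> h x"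
    for \<gamma> and \<gamma>' :: complex and H h :: "real \<Rightarrow> real" and s t
  proof (rule differentiable_bound_general[OF st])
    have 1: "((\<lambda>x. G (\<gamma> x)) has_vector_derivative weber_U a (\<gamma> x) * \<gamma>') (at x)" for x
      using field_vector_diff_chain_at[OF \<gamma> G] by (simp add: o_def mult.commute)
    have 2: "(H has_vector_derivative h x) (at x)" for x
      using H by (simp add: has_real_derivative_iff_has_vector_derivative)
    show "continuous_on {s..t} (\<lambda>x. G (\<gamma> x))"
      using 1 by (intro continuous_at_imp_continuous_on ballI) (rule has_vector_derivative_continuous)
    show "continuous_on {s..t} H"
      using 2 by (intro continuous_at_imp_continuous_on ballI) (rule has_vector_derivative_continuous)
    fix x assume "s < x" "x < t"
    then show "norm (weber_U a (\<gamma> x) * \<gamma>') \<le> h x" by (rule le)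
    show "((\<lambda>x. G (\<gamma> x)) has_vector_derivative weber_U a (\<gamma> x) * \<gamma>') (at x)" by (rule 1)
    show "(H has_vector_derivative h x) (at x)" by (rule 2)
  qed
  \<comment> \<open>For x \<ge> 4 one has x^2/4 \<ge> x, so the Gaussian may be replaced by exp(-x),
    which has an explicit primitive.\<close>
  define M where "M = max R 4"
  have tail: "norm (G (of_real t) - G (of_real s)) \<le> C * exp (- s)" if s: "M \<le> s" "s < t" for s t
  proof -
    have "norm (G (of_real t) - G (of_real s)) \<le> - C * exp (- t) - - C * exp (- s)"
    proof (rule curve[OF s(2)])
      show "(complex_of_real has_vector_derivative 1) (at x)" for x
        using has_vector_derivative_of_real[OF DERIV_ident, of "at x"] by simp
      show "((\<lambda>x. - C * exp (- x)) has_real_derivative C * exp (- x)) (at x)" for x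
        by (auto intro!: derivative_eq_intros)
      fix x assume "s < x" "x < t"
      then have x: "x \<ge> R" "x \<ge> 4" using s by (auto simp: M_def)
      have "norm (weber_U a (of_real x)) \<le> C * exp (- Re ((of_real x)\<^sup>2) / 4)"
        using x RC(1) by (intro RC(3)) auto
      also have "\<dots> \<le> C * exp (- x)"
        using x RC(2) by (intro mult_left_mono) (auto simp: power2_eq_square)
      finally show "norm (weber_U a (of_real x) * 1) \<le> C * exp (- x)" by simp
    qed
    also have "\<dots> \<le> C * exp (- s)" using RC(2) by simp
    finally show ?thesis .
  qed
  have Cexp: "((\<lambda>s. C * exp (- s)) \<longlongrightarrow> 0) at_top"
    by (intro tendsto_mult_right_zero filterlim_compose[OF exp_at_bot filterlim_uminus_at_bot_at_top])
  \<comment> \<open>Completeness gives L along the integers; the same tail bound, passed to the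
    limit, then covers all real T.\<close>
  have "Cauchy (\<lambda>n. G (of_real (real n)))"
  proof (rule metric_CauchyI)
    fix e :: real assume "e > 0"
    from order_tendstoD(2)[OF Cexp this] have "eventually (\<lambda>s. C * exp (- s) < e) at_top" .
    then obtain N where N: "\<And>s. s \<ge> N \<Longrightarrow> C * exp (- s) < e" by (auto simp: eventually_at_top_linorder)
    obtain K :: nat where K: "real K \<ge> max N M" using real_arch_simple by blast
    have lt: "dist (G (of_real (real n))) (G (of_real (real m))) < e" if "m \<ge> K" "m < n" for m n
    proof -
      have "real m \<ge> max N M" using K that by simp
      then show ?thesis using tail[of m n] N[of m] that by (simp add: dist_norm)
    qed
    have "dist (G (of_real (real m))) (G (of_real (real n))) < e" if "m \<ge> K" "n \<ge> K" for m n
      using lt[of m n] lt[of n m] that \<open>e > 0\<close> by (cases m n rule: linorder_cases) (auto simp: dist_commute)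
    then show "\<exists>K. \<forall>m\<ge>K. \<forall>n\<ge>K. dist (G (of_real (real m))) (G (of_real (real n))) < e" by blast
  qed
  then obtain L where L: "(\<lambda>n. G (of_real (real n))) \<longlonglongrightarrow> L"
    using Cauchy_convergent convergent_def by blast
  have "eventually (\<lambda>T. norm (G (of_real T) - L) \<le> C * exp (- T)) at_top"
    using eventually_ge_at_top[of M]
  proof eventually_elim
    case (elim T)
    have "norm (L - G (of_real T)) \<le> C * exp (- T)"
    proof (rule tendsto_upperbound)
      show "(\<lambda>n. norm (G (of_real (real n)) - G (of_real T))) \<longlonglongrightarrow> norm (L - G (of_real T))"
        by (intro tendsto_intros L)
      have "eventually (\<lambda>n. real n > T) sequentially"
        using filterlim_real_sequentially by (simp add: filterlim_at_top_dense)
      then show "eventually (\<lambda>n. norm (G (of_real (real n)) - G (of_real T)) \<le> C * exp (- T)) sequentially"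
        by eventually_elim (rule tail[OF elim])
    qed auto
    then show ?case by (simp add: norm_minus_commute)
  qed
  from Lim_null_comparison[OF this Cexp] have GL: "((\<lambda>T. G (of_real T)) \<longlongrightarrow> L) at_top"
    by (simp add: LIM_zero_iff)
  show ?thesis
  proof (rule that[of L])
    fix w :: complex
    define c where "c = norm w"
    \<comment> \<open>A shift by w does not change the limit: on the disc of radius |w| about T the
      derivative of G is bounded by a quantity that tends to 0 as T grows.\<close>
    have "eventually (\<lambda>T. norm (G (w + of_real T) - G (of_real T)) \<le> C * exp (- ((T - c)\<^sup>2 - c\<^sup>2) / 4) * c) at_top"
      using eventually_ge_at_top[of "R + c"]
    proof eventually_elim
      case (elim T)
      have "norm (G (w + of_real T) - G (of_real T)) \<le> C * exp (- ((T - c)\<^sup>2 - c\<^sup>2) / 4) * norm (w + of_real T - of_real T)"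
      proof (rule field_differentiable_bound[where S = "cball (of_real T) c"])
        fix z assume "z \<in> cball (complex_of_real T) c"
        then have "\<bar>Re z - T\<bar> \<le> c" "\<bar>Im z\<bar> \<le> c"
          using abs_Re_le_cmod[of "z - of_real T"] abs_Im_le_cmod[of "z - of_real T"]
          by (auto simp: dist_norm norm_minus_commute)
        then have z: "Re z \<ge> T - c" "(Im z)\<^sup>2 \<le> c\<^sup>2"
          by (auto simp: abs_le_square_iff[symmetric])
        then have "Re z \<ge> R" using elim by simp
        then have "norm (weber_U a z) \<le> C * exp (- Re (z\<^sup>2) / 4)"
          using RC(1) complex_Re_le_cmod[of z] by (intro RC(3)) linarith+
        also have "\<dots> \<le> C * exp (- ((T - c)\<^sup>2 - c\<^sup>2) / 4)"
        proof -
          have "(T - c)\<^sup>2 \<le> (Re z)\<^sup>2" using z elim RC(1) by (intro power_mono) auto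
          then show ?thesis using RC(2) z by (intro mult_left_mono) (auto simp: Re_power2)
        qed
        finally show "norm (weber_U a z) \<le> C * exp (- ((T - c)\<^sup>2 - c\<^sup>2) / 4)" .
        show "(G has_field_derivative weber_U a z) (at z within cball (of_real T) c)"
          using G by (rule has_field_derivative_at_within)
      qed (auto simp: c_def dist_norm)
      then show ?case by (simp add: c_def)
    qed
    moreover have "((\<lambda>T. C * exp (- ((T - c)\<^sup>2 - c\<^sup>2) / 4) * c) \<longlongrightarrow> 0) at_top"
    proof (intro tendsto_mult_left_zero tendsto_mult_right_zero)
      show "((\<lambda>T::real. exp (- ((T - c)\<^sup>2 - c\<^sup>2) / 4)) \<longlongrightarrow> 0) at_top"
        by real_asymp
    qed
    ultimately have "((\<lambda>T. G (w + of_real T) - G (of_real T)) \<longlongrightarrow> 0) at_top"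
      by (rule Lim_null_comparison)
    from tendsto_add[OF this GL] show "((\<lambda>T. G (w + of_real T)) \<longlongrightarrow> L) at_top" by simp
  next
    fix \<omega> :: complex assume \<omega>: "norm \<omega> = 1" "Re \<omega> > 0" "Re (\<omega>\<^sup>2) = 0"
    \<comment> \<open>The segment has length T and ends at T \<omega> + T cnj \<omega> = r T on the
      real axis. The bound C exp(-T x/2) along it integrates to at most 2 C / T.\<close>
    define r where "r = 2 * Re \<omega>"
    have r: "r > 0" using \<omega> by (simp add: r_def)
    have "eventually (\<lambda>T. norm (G (of_real T * \<omega>) - G (of_real (r * T))) \<le> 2 * C / T) at_top"
      using eventually_ge_at_top[of "max 1 (R / Re \<omega>)"]
    proof eventually_elim
      case (elim T)
      then have T: "T > 0" "T * Re \<omega> \<ge> R" using \<omega> by (auto simp: field_simps)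
      define \<gamma> where "\<gamma> = (\<lambda>y. of_real T * \<omega> + of_real y * cnj \<omega>)"
      have "norm (G (\<gamma> T) - G (\<gamma> 0)) \<le> - (2 * C / T) * exp (- (T * T / 2)) - - (2 * C / T) * exp (- (T * 0 / 2))"
      proof (rule curve[OF T(1)])
        show "(\<gamma> has_vector_derivative cnj \<omega>) (at x)" for x
          unfolding \<gamma>_def by (auto intro!: derivative_eq_intros)
        show "((\<lambda>x. - (2 * C / T) * exp (- (T * x / 2))) has_real_derivative C * exp (- (T * x / 2))) (at x)" for x
          using T by (auto intro!: derivative_eq_intros)
        fix x assume x: "0 < x" "x < T"
        have Re\<gamma>: "Re (\<gamma> x) = (T + x) * Re \<omega>" by (simp add: \<gamma>_def algebra_simps)
        have "(T + x) * Re \<omega> \<ge> T * Re \<omega>" using x \<omega> by (intro mult_right_mono) auto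
        then have "Re (\<gamma> x) \<ge> R" using Re\<gamma> T by linarith
        then have "norm (weber_U a (\<gamma> x)) \<le> C * exp (- Re ((\<gamma> x)\<^sup>2) / 4)"
          using RC(1) complex_Re_le_cmod[of "\<gamma> x"] by (intro RC(3)) linarith+
        also have "Re ((\<gamma> x)\<^sup>2) = 2 * T * x"
        proof -
          have "\<omega> * cnj \<omega> = 1" using \<omega>(1) by (simp flip: complex_norm_square)
          then have "(\<gamma> x)\<^sup>2 = of_real (T\<^sup>2) * \<omega>\<^sup>2 + of_real (x\<^sup>2) * cnj (\<omega>\<^sup>2) + of_real (2 * T * x)"
            by (simp add: \<gamma>_def power2_eq_square algebra_simps)
          moreover have "Re ((cnj \<omega>)\<^sup>2) = 0" using \<omega>(3) by (simp add: Re_power2)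
          ultimately show ?thesis using \<omega>(3) by simp
        qed
        finally show "norm (weber_U a (\<gamma> x) * cnj \<omega>) \<le> C * exp (- (T * x / 2))"
          using \<omega>(1) by (simp add: norm_mult)
      qed
      also have "\<dots> \<le> 2 * C / T" using T RC(2) by simp
      also have "\<gamma> T = of_real (r * T)"
        by (simp add: \<gamma>_def r_def complex_eq_iff)
      also have "\<gamma> 0 = of_real T * \<omega>" by (simp add: \<gamma>_def)
      finally show ?case by (simp add: norm_minus_commute)
    qed
    moreover have "((\<lambda>T. 2 * C / T) \<longlongrightarrow> 0) at_top"
      by real_asymp
    ultimately have 1: "((\<lambda>T. G (of_real T * \<omega>) - G (of_real (r * T))) \<longlongrightarrow> 0) at_top"
      by (rule Lim_null_comparison)
    have "filterlim (\<lambda>T. r * T) at_top at_top"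
      using r by (intro filterlim_tendsto_pos_mult_at_top[OF tendsto_const] filterlim_ident) auto
    from filterlim_compose[OF GL this] have "((\<lambda>T. G (of_real (r * T))) \<longlongrightarrow> L) at_top" .
    from tendsto_add[OF 1 this] show "((\<lambda>T. G (of_real T * \<omega>)) \<longlongrightarrow> L) at_top" by simp
  qed
qed

text \<open>Take P(z) = G(z \<omega>)/\<omega> with G a primitive of U. Moving z in direction cnj
  \<omega> moves z \<omega> in the real direction, while moving z along the real axis moves z
  \<omega> along the ray of \<omega>; G has one limit for both. This shared \<Lambda> is what
  replaces a contour deformation.\<close>

lemma weber_U_rotated_primitive:
  assumes a: "Re a > -1/2" and \<omega>: "norm \<omega> = 1" "Re \<omega> > 0" "Re (\<omega>\<^sup>2) = 0"
  obtains P \<Lambda> where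
    "\<And>z. (P has_field_derivative weber_U a (z * \<omega>)) (at z)"
    "\<And>z. ((\<lambda>T. P (z + of_real T * cnj \<omega>)) \<longlongrightarrow> \<Lambda>) at_top"
    "((\<lambda>T. P (of_real T)) \<longlongrightarrow> \<Lambda>) at_top"
proof -
  obtain U1 where "ode_sol (\<lambda>z. z\<^sup>2 / 4 + a) (weber_U a) U1"
    using weber_U_ode[OF a] by blast
  then have "weber_U a holomorphic_on UNIV" by (rule ode_sol_holomorphic)
  then obtain G where G: "\<And>z. (G has_field_derivative weber_U a z) (at z)"
    using holomorphic_convex_primitive'[of UNIV "weber_U a"] by (auto simp: convex_UNIV)
  obtain L where L: "\<And>w. ((\<lambda>T. G (w + of_real T)) \<longlongrightarrow> L) at_top"
    "((\<lambda>T. G (of_real T * \<omega>)) \<longlongrightarrow> L) at_top"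
  proof (rule weber_U_primitive_limit[OF a G])
    fix L assume 1: "\<And>w. ((\<lambda>T. G (w + of_real T)) \<longlongrightarrow> L) at_top"
      and 2: "\<And>\<omega>. norm \<omega> = 1 \<Longrightarrow> Re \<omega> > 0 \<Longrightarrow> Re (\<omega>\<^sup>2) = 0 \<Longrightarrow> ((\<lambda>T. G (of_real T * \<omega>)) \<longlongrightarrow> L) at_top"
    show thesis by (rule that[OF 1 2[OF \<omega>]])
  qed
  have \<omega>nz: "\<omega> \<noteq> 0" using \<omega> by auto
  have \<omega>c: "cnj \<omega> * \<omega> = 1" using \<omega>(1) by (simp add: mult.commute flip: complex_norm_square)
  have "((\<lambda>z. G (z * \<omega>) / \<omega>) has_field_derivative weber_U a (z * \<omega>)) (at z)" for z
  proof -
    have "((\<lambda>z. G (z * \<omega>)) has_field_derivative weber_U a (z * \<omega>) * \<omega>) (at z)"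
      by (rule DERIV_chain2[OF G]) (auto intro!: derivative_eq_intros)
    from DERIV_cdivide[OF this, of \<omega>] show ?thesis using \<omega>nz by simp
  qed
  moreover have "((\<lambda>T. G ((z + of_real T * cnj \<omega>) * \<omega>) / \<omega>) \<longlongrightarrow> L / \<omega>) at_top" for z
    using tendsto_divide[OF L(1)[of "z * \<omega>"] tendsto_const \<omega>nz] by (simp add: distrib_right mult.assoc \<omega>c)
  moreover have "((\<lambda>T. G (of_real T * \<omega>) / \<omega>) \<longlongrightarrow> L / \<omega>) at_top"
    by (rule tendsto_divide[OF L(2) tendsto_const \<omega>nz])
  ultimately show ?thesis by (rule that)
qed

section \<open>The integrals in terms of primitives\<close>

lemma int_from_inf_eq:
  assumes P: "\<And>z. (P has_field_derivative f z) (at z)"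
    and lim: "((\<lambda>T. P (z + of_real T * \<omega>)) \<longlongrightarrow> \<Lambda>) at_top"
  shows "int_from_inf \<omega> f z = P z - \<Lambda>"
proof -
  have "contour_integral (linepath z w) f = P w - P z" for w
    using contour_integral_primitive[of UNIV P f "linepath z w"] P
    by (intro contour_integral_unique) auto
  then have "Lim at_top (\<lambda>T::real. contour_integral (linepath z (z + of_real T * \<omega>)) f) = \<Lambda> - P z"
    by (intro tendsto_Lim) (auto intro!: tendsto_intros lim)
  then show ?thesis by (simp add: int_from_inf_def)
qed

lemma improper_int_eq:
  assumes P: "\<And>z. (P has_field_derivative f z) (at z)"
    and lim: "((\<lambda>T. P (of_real T)) \<longlongrightarrow> \<Lambda>) at_top"
  shows "improper_int (\<lambda>t. f (of_real t)) x = \<Lambda> - P (of_real x)"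
  unfolding improper_int_def
proof (rule tendsto_Lim)
  have FTC: "((\<lambda>t. f (of_real t)) has_integral P (of_real T) - P (of_real x)) {x..T}" if "x \<le> T" for T
    using that
  proof (rule fundamental_theorem_of_calculus)
    fix t
    show "((\<lambda>t. P (of_real t)) has_vector_derivative f (of_real t)) (at t within {x..T})"
      using field_vector_diff_chain_within[OF has_vector_derivative_of_real[OF DERIV_ident]
          has_field_derivative_at_within[OF P], of t "{x..T}"] by (simp add: o_def)
  qed
  \<comment> \<open>For T < x the interval is empty and the integral is 0, so the identity is
    claimed only from T = x on.\<close>
  have "eventually (\<lambda>T. P (of_real T) - P (of_real x) = integral {x..T} (\<lambda>t. f (of_real t))) at_top"
    using eventually_ge_at_top[of x] by eventually_elim (simp add: integral_unique[OF FTC])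
  then show "((\<lambda>T. integral {x..T} (\<lambda>t. f (of_real t))) \<longlongrightarrow> \<Lambda> - P (of_real x)) at_top"
    by (rule Lim_transform_eventually[rotated]) (intro tendsto_intros lim)
qed auto

text \<open>An entire function is determined by its values on the real axis, so holomorphy and
  agreement there express that the right-hand side is the analytic continuation.\<close>

theorem theorem2p1:
  fixes a :: real
  shows "(W03 0 a) holomorphic_on UNIV \<and>
         (\<forall>x::real. W03 0 a (complex_of_real x) = NW_hat a x) \<and>
         (\<forall>z. W03 0 a z = \<i> * complex_of_real (exp (pi * a / 2)) *
             (Wj 3 a z * int_from_inf (exp (pi * \<i> / 4)) (Wj 0 a) z
              - Wj 0 a z * int_from_inf (exp (- pi * \<i> / 4)) (Wj 3 a) z))"
proof -
  define c where "c = exp (complex_of_real pi * \<i> / 4)"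
  have cnj_c: "exp (- pi * \<i> / 4) = cnj c"
    by (simp add: c_def exp_cnj)
  have c: "norm c = 1" "Re c > 0" "Re (c\<^sup>2) = 0"
  proof -
    have "c = cis (pi / 4)" by (simp add: c_def cis_conv_exp mult_ac)
    then show "norm c = 1" "Re c > 0" "Re (c\<^sup>2) = 0"
      by (auto simp: cos_45 sin_45 Re_power2)
  qed
  have W0: "Wj 0 a z = weber_U (\<i> * of_real a) (z * cnj c)" for z
    unfolding Wj_0 cnj_c ..
  have W3: "Wj 3 a z = weber_U (- (\<i> * of_real a)) (z * c)" for z
    unfolding Wj_3 c_def ..
  \<comment> \<open>Here \<omega> = cnj c, so the decay direction cnj \<omega> is c, the ray of the
    first integral in \<open>W03\<close>. For W_3 the roles of c and cnj c are exchanged.\<close>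
  obtain P0 \<Lambda>0 where P0: "\<And>z. (P0 has_field_derivative Wj 0 a z) (at z)"
    "\<And>z. ((\<lambda>T. P0 (z + of_real T * c)) \<longlongrightarrow> \<Lambda>0) at_top" "((\<lambda>T. P0 (of_real T)) \<longlongrightarrow> \<Lambda>0) at_top"
  proof (rule weber_U_rotated_primitive[of "\<i> * of_real a" "cnj c", folded W0, unfolded complex_cnj_cnj])
    fix P \<Lambda> assume 1: "\<And>z. (P has_field_derivative Wj 0 a z) (at z)"
      and 2: "\<And>z. ((\<lambda>T. P (z + of_real T * c)) \<longlongrightarrow> \<Lambda>) at_top"
      and 3: "((\<lambda>T. P (of_real T)) \<longlongrightarrow> \<Lambda>) at_top"
    show thesis by (rule that[OF 1 2 3])
  qed (use c in \<open>auto simp: Re_power2\<close>)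
  obtain P3 \<Lambda>3 where P3: "\<And>z. (P3 has_field_derivative Wj 3 a z) (at z)"
    "\<And>z. ((\<lambda>T. P3 (z + of_real T * cnj c)) \<longlongrightarrow> \<Lambda>3) at_top" "((\<lambda>T. P3 (of_real T)) \<longlongrightarrow> \<Lambda>3) at_top"
  proof (rule weber_U_rotated_primitive[of "- (\<i> * of_real a)" c, folded W3])
    fix P \<Lambda> assume 1: "\<And>z. (P has_field_derivative Wj 3 a z) (at z)"
      and 2: "\<And>z. ((\<lambda>T. P (z + of_real T * cnj c)) \<longlongrightarrow> \<Lambda>) at_top"
      and 3: "((\<lambda>T. P (of_real T)) \<longlongrightarrow> \<Lambda>) at_top"
    show thesis by (rule that[OF 1 2 3])
  qed (use c in auto)
  have W03_int: "W03 0 a z = \<i> * complex_of_real (exp (pi * a / 2)) *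
             (Wj 3 a z * int_from_inf (exp (pi * \<i> / 4)) (Wj 0 a) z
              - Wj 0 a z * int_from_inf (exp (- pi * \<i> / 4)) (Wj 3 a) z)" for z
    by (simp add: W03_def)
  have W03_eq: "W03 0 a z = \<i> * complex_of_real (exp (pi * a / 2)) *
     (Wj 3 a z * (P0 z - \<Lambda>0) - Wj 0 a z * (P3 z - \<Lambda>3))" for z
    unfolding W03_int cnj_c c_def[symmetric] int_from_inf_eq[OF P0(1,2)] int_from_inf_eq[OF P3(1,2)] ..
  have hol: "P0 holomorphic_on UNIV" "P3 holomorphic_on UNIV"
    using P0(1) P3(1) by (auto simp: holomorphic_on_open)
  then have "deriv P0 holomorphic_on UNIV" "deriv P3 holomorphic_on UNIV"
    by (auto intro: holomorphic_deriv)
  moreover have "deriv P0 = Wj 0 a" "deriv P3 = Wj 3 a"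
    using P0(1) P3(1) by (auto intro!: DERIV_imp_deriv)
  ultimately have "W03 0 a holomorphic_on UNIV"
    unfolding W03_eq[abs_def] using hol by (auto intro!: holomorphic_intros)
  moreover have "W03 0 a (of_real x) = NW_hat a x" for x
  proof -
    define e where "e = exp (\<i> * complex_of_real (rhoW a))"
    have enz: "e \<noteq> 0" by (simp add: e_def)
    have e': "exp (- \<i> * of_real (rhoW a)) = inverse e" by (simp add: e_def exp_minus)
    define A where "A = complex_of_real (sqrt (kW a / 2) * exp (pi * a / 4))"
    define K where "K = sqrt (1 + exp (2 * pi * a)) + exp (pi * a)"
    define B where "B = - \<i> * of_real K * A"
    have kW: "kW a > 0"
      using kW_mult[of a] by (smt (verit) exp_gt_zero mult_nonneg_nonneg real_sqrt_ge_zero zero_less_mult_pos2)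
    \<comment> \<open>A^2 = (k/2) e^(\<pi> a/2) and B = -i A/k, so k cancels in 2 A B and the
      prefactor of \<open>W03\<close> appears up to sign.\<close>
    have "2 * (sqrt (kW a / 2) * exp (pi * a / 4)) * (sqrt (kW a / 2) * exp (pi * a / 4)) = kW a * (exp (pi * a / 4) * exp (pi * a / 4))"
      using kW by simp
    also have "\<dots> = kW a * exp (pi * a / 2)" by (simp flip: exp_add)
    finally have "2 * A * A = of_real (kW a * exp (pi * a / 2))"
      unfolding A_def by (metis of_real_mult of_real_numeral)
    moreover have "2 * A * B = - \<i> * of_real K * (2 * A * A)"
      by (simp add: B_def)
    ultimately have "2 * A * B = - \<i> * of_real (kW a * K * exp (pi * a / 2))"
      by simp
    then have AB: "2 * A * B = - \<i> * of_real (exp (pi * a / 2))"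
      unfolding K_def kW_mult by simp
    have Wp: "Wc a z = A * (e * Wj 0 a z + inverse e * Wj 3 a z)" for z
      unfolding Wc_def A_def e_def[symmetric] e' ..
    have Wm: "Wc a (- z) = B * (e * Wj 0 a z - inverse e * Wj 3 a z)" for z
      unfolding Wc_minus A_def[symmetric] B_def K_def e_def[symmetric] e' ..
    have Ip: "improper_int (\<lambda>t. Wc a (of_real t)) x =
        A * (e * \<Lambda>0 + inverse e * \<Lambda>3) - A * (e * P0 (of_real x) + inverse e * P3 (of_real x))"
      by (rule improper_int_eq[where P = "\<lambda>z. A * (e * P0 z + inverse e * P3 z)"])
        (auto simp: Wp intro!: derivative_eq_intros P0 P3 tendsto_intros)
    have Im: "improper_int (\<lambda>t. Wc a (- of_real t)) x =
        B * (e * \<Lambda>0 - inverse e * \<Lambda>3) - B * (e * P0 (of_real x) - inverse e * P3 (of_real x))"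
      by (rule improper_int_eq[where P = "\<lambda>z. B * (e * P0 z - inverse e * P3 z)" and f = "\<lambda>z. Wc a (- z)"])
        (auto simp: Wm intro!: derivative_eq_intros P0 P3 tendsto_intros)
    \<comment> \<open>With u = e W_0, v = e^(-1) W_3 and their integrals I_u, I_v from x to
      infinity, (u + v)(I_u - I_v) - (u - v)(I_u + I_v) = 2 (v I_u - u I_v). The phases cancel in
      the mixed products; the minus sign of 2 A B is absorbed by reversing the direction of
      integration.\<close>
    have "NW_hat a x = (2 * A * B) * (e * inverse e) *
       (Wj 0 a (of_real x) * (P3 (of_real x) - \<Lambda>3) - Wj 3 a (of_real x) * (P0 (of_real x) - \<Lambda>0))"
      unfolding NW_hat_def of_real_minus Ip Im unfolding Wm unfolding Wp by (simp add: algebra_simps)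
    then show ?thesis
      unfolding AB W03_eq using enz by (simp add: algebra_simps)
  qed
  ultimately show ?thesis using W03_int by blast
qed

end
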